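(* Let $N\ge 1$ and $q\ge 2$ be integers, $b=qN$, $\mathcal D=\{0,1,\ldots,N-1\}$ and $\mathcal C=(-\frac N2,\frac N2]\cap\mathbb Z$. Let $\Gamma$ be the set of all positive complete numbers of the spectral pair $(\mu_{b,q\mathcal D},\Lambda(b,\mathcal C))$. Then $$\limsup_{x\to\infty}\frac{\#(\Gamma\cap[0,x])}{x}\le c\cdot\frac{\varphi(N)}{N},$$ where $\varphi$ is Euler's function and $0<c<1$ is a constant depending on $b$. Moreover, if $q>N$, then $$\liminf_{x\to\infty}\frac{\#(\Gamma\cap[0,x])}{\pi(x)}\ge 1,$$ where $\pi(x)$ is the prime-counting function.
   Context: For a finite set $B\subset\mathbb R$ and $\rho>1$, $\mu_{\rho,B}$ is the unique Borel probability measure on $\mathbb R$ with $\mu_{\rho,B}(\cdot)=\frac1{\#B}\sum_{a\in B}\mu_{\rho,B}\circ\phi_a^{-1}(\cdot)$, where $\phi_a(x)=\rho^{-1}(x+a)$. Put $q\mathcal D=\{qd:d\in\mathcal D\}$ and $\Lambda(b,\mathcal C)=\{\sum_{k=0}^n b^kc_k: n\ge 0,\ c_k\in\mathcal C\}$. A pair $(\mu,\Lambda)$ of a compactly supported Borel probability measure on $\mathbb R$ and a countable set $\Lambda\subset\mathbb R$ is a spectral pair if $\{e^{-2\pi i\lambda x}:\lambda\in\Lambda\}$ is an orthonormal basis of $L^2(\mu)$. It is known that $(\mu_{b,q\mathcal D},\Lambda(b,\mathcal C))$ is a spectral pair. A real number $t$ is a complete number (of this pair) if $(\mu_{b,q\mathcal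 D},t\Lambda(b,\mathcal C))$ is also a spectral pair, and an incomplete number otherwise.
   Formalization: The limsup bound is asserted only for N ≥ 2: for N = 1 the measure is the Dirac mass at 0 and Λ = {0}, so every t > 0 is complete, Γ = (0,∞), and the limsup is infinite, so the bound fails. The liminf claim is kept for all N ≥ 1. *)

theory Defs
  imports "HOL-Probability.Probability" "HOL-Number_Theory.Number_Theory"
begin

definition ifs_map :: "real \<Rightarrow> real \<Rightarrow> real \<Rightarrow> real" where
  "ifs_map \<rho> a x = (x + a) / \<rho>"

definition self_similar :: "real \<Rightarrow> real set \<Rightarrow> real measure \<Rightarrow> bool" where
  "self_similar \<rho> B \<mu> \<longleftrightarrow>
     prob_space \<mu> \<and> sets \<mu> = sets borel \<and>
     (\<forall>A \<in> sets borel. measure \<mu> A =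
        1 / real (card B) * (\<Sum>a\<in>B. measure \<mu> (ifs_map \<rho> a -` A)))"

(* Meaningful for finite nonempty B and \<rho> > 1, where the self-similar measure exists and is unique. *)
definition ss_measure :: "real \<Rightarrow> real set \<Rightarrow> real measure" where
  "ss_measure \<rho> B = (THE \<mu>. self_similar \<rho> B \<mu>)"

definition digit_sums :: "real \<Rightarrow> real set \<Rightarrow> real set" where
  "digit_sums b C = {\<Sum>k=0..n. b ^ k * c k | n c. \<forall>k. c k \<in> C}"

definition expo :: "real \<Rightarrow> real \<Rightarrow> complex" where
  "expo l x = exp (- 2 * complex_of_real pi * \<i> * complex_of_real l * complex_of_real x)"

definition square_integrable :: "real measure \<Rightarrow> (real \<Rightarrow> complex) \<Rightarrow> bool" where
  "square_integrable \<mu> f \<longleftrightarrow> f \<in> borel_measurable \<mu> \<and> integrable \<mu> (\<lambda>x. (cmod (f x))\<^sup>2)"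

(* An orthonormal basis of L^2 is an orthonormal family whose linear span is dense. The
   exponentials are treated as a family indexed by \<Lambda>: distinct frequencies must give
   orthogonal functions. L^2 is handled through representatives, so density is expressed by
   the squared L^2 distance. *)
definition orthonormal_exponentials :: "real measure \<Rightarrow> real set \<Rightarrow> bool" where
  "orthonormal_exponentials \<mu> \<Lambda> \<longleftrightarrow>
     (\<forall>l\<in>\<Lambda>. \<forall>m\<in>\<Lambda>. (\<integral>x. expo l x * cnj (expo m x) \<partial>\<mu>) = (if l = m then 1 else 0))"

definition total_exponentials :: "real measure \<Rightarrow> real set \<Rightarrow> bool" where
  "total_exponentials \<mu> \<Lambda> \<longleftrightarrow>
     (\<forall>f. square_integrable \<mu> f \<longrightarrow>
        (\<forall>\<epsilon>>0. \<exists>F u. finite F \<and> F \<subseteq> \<Lambda> \<and>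
           (\<integral>x. (cmod (f x - (\<Sum>l\<in>F. u l * expo l x)))\<^sup>2 \<partial>\<mu>) < \<epsilon>))"

definition spectral_pair :: "real measure \<Rightarrow> real set \<Rightarrow> bool" where
  "spectral_pair \<mu> \<Lambda> \<longleftrightarrow>
     prob_space \<mu> \<and> sets \<mu> = sets borel \<and> (\<exists>K. compact K \<and> measure \<mu> (- K) = 0) \<and>
     countable \<Lambda> \<and> orthonormal_exponentials \<mu> \<Lambda> \<and> total_exponentials \<mu> \<Lambda>"

definition complete_number :: "real measure \<Rightarrow> real set \<Rightarrow> real \<Rightarrow> bool" where
  "complete_number \<mu> \<Lambda> t \<longleftrightarrow> spectral_pair \<mu> ((*) t ` \<Lambda>)"

definition D_set :: "nat \<Rightarrow> real set" where
  "D_set N = real ` {0..<N}"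

definition C_set :: "nat \<Rightarrow> real set" where
  "C_set N = {- (real N / 2) <.. real N / 2} \<inter> \<int>"

definition positive_complete_numbers :: "nat \<Rightarrow> nat \<Rightarrow> real set" where
  "positive_complete_numbers N q =
     {t. t > 0 \<and> complete_number (ss_measure (real (q * N)) ((*) (real q) ` D_set N))
                                 (digit_sums (real (q * N)) (C_set N)) t}"

(* Counting measure rather than card, so that an infinite set has infinitely many elements. *)
definition num_elements :: "'a set \<Rightarrow> ennreal" where
  "num_elements A = emeasure (count_space UNIV) A"

definition prime_count :: "real \<Rightarrow> nat" where
  "prime_count x = card {p::nat. prime p \<and> real p \<le> x}"

end

(* The Fourier transform of the self-similar measure \<mu> satisfies F \<xi> = mask (\<xi> / b) * F (\<xi> / b); it
   vanishes exactly at the integers b^j r with N not dividing r.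

   Upper bound (N > 1): 1 \<in> C forces F t = 0, so a complete number t is an integer. If gcd t N > 1, then
   the exponential of frequency 1 is orthogonal to all those in t \<Lambda>; if gcd t N = 1 and b - 1 divides t,
   then so is the one of frequency -t / (b - 1), whose b-adic expansion is t + t b + t b^2 + ... The remaining integers have density \<phi>(N)/N * (1 - 1/(b - 1)).

   Lower bound: for a prime p not dividing b, the sums Q(\<xi>) of |F|^2 over \<xi> + p \<Lambda> satisfy
   Q(\<xi>) = sum over c of |mask(\<tau>_c \<xi>)|^2 Q(\<tau>_c \<xi>), with weights summing to 1 and \<tau>_c \<xi> = (\<xi> + p c) / b.
   If Q is not constantly 1, its minimal points form a finite set of nonzero integers, each of which is
   mapped into the set by some \<tau>_c. This forces the order of b modulo p to be at most about
   p^(log N / log b), where the exponent is below 1/2 since q > N. There are only O(x^(2 log N / log b)) such primes up to x, which is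
   negligible against Chebyshev's lower bound for \<pi>(x). Otherwise Q = 1, all exponentials lie in the
   closed span of those in p \<Lambda>, and Stone-Weierstrass gives totality. *)

theory Submission
  imports Defs
begin

section \<open>Prime counting and counting in residue classes\<close>

text \<open>For \<open>N = 1\<close> the measure is the point mass at 0 and every positive real is
  complete. The upper bound then fails, so it is claimed only for \<open>N \<noteq> 1\<close>; the
  lower bound survives because the count is infinite. In the upper bound, b - 1 is coprime to N, so
  the two exclusions are independent and their densities multiply. The frequency -t / (b - 1) would
  need infinitely many digits 1, so it departs from each member of t \<Lambda> at some first digit,
  and that digit produces a zero of the transform. The lower bound does not decide which primes are
  complete. Incompleteness only yields a witness that bounds the order of b modulo p, and this helps
  because primes of small order are rare: each divides some b^n - 1 with n \<le> m, and these
  numbers have O(m^2) prime factors altogether. With m = N^k for the primes up to b^k, the square is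
  what demands N^2 < b, that is q > N.\<close>

lemma mult_binomial_dvd:
  fixes n k L :: nat
  assumes "\<And>i. i \<in> {1..n} \<Longrightarrow> i dvd L" "1 \<le> k" "k \<le> n"
  shows "k * (n choose k) dvd L"
proof -
  have dvd_iff: "real L / real a \<in> \<int> \<longleftrightarrow> a dvd L" if "a > 0" for a
  proof
    assume "real L / real a \<in> \<int>"
    then obtain z where "real L / real a = of_int z" by (auto elim: Ints_cases)
    hence "real L = of_int (z * int a)" using that by (simp add: field_simps)
    hence "int L = z * int a" by (metis of_int_eq_iff of_int_of_nat_eq)
    thus "a dvd L" by (metis dvd_triv_right of_nat_dvd_iff)
  qed (auto simp: dvd_def)
  have "real L / real (k * (n choose k)) \<in> \<int>"
    using assms(2,3,1)
  proof (induction n arbitrary: k)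
    case (Suc n)
    show ?case using Suc.prems(2,1)
    proof (induction k rule: inc_induct)
      case base
      show ?case using Suc.prems(3)[of "Suc n"] by (subst dvd_iff) auto
    next
      case (step k)
      have k: "k \<le> n" "k \<ge> 1" using step by auto
      let ?B = "real (Suc n choose k)"
      have B: "?B > 0" using k by simp
      have e1: "real (Suc k) * real (Suc n choose Suc k) = real (Suc n - k) * ?B"
        by (metis (no_types, lifting) binomial_absorb_comp binomial_absorption diff_Suc_1 of_nat_mult)
      have e2: "real (Suc n - k) * ?B = real (Suc n) * real (n choose k)"
        by (metis (no_types, lifting) binomial_absorb_comp diff_Suc_1 of_nat_mult)
      have d: "real (Suc n - k) = real (Suc n) - real k" using k by auto
      \<comment> \<open>The recurrence of Leibniz' harmonic triangle: each entry 1 / (k * (n choose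
        k)) is the sum of two adjacent entries of the next row. It is the reason for working with
        quotients instead of divisibility.\<close>
      have "real L / (real k * ?B)
          = real L / (real k * real (n choose k)) - real L / (real (Suc k) * real (Suc n choose Suc k))"
      proof -
        have nk: "real (n choose k) = real (Suc n - k) * ?B / real (Suc n)"
          using e2 by (simp add: field_simps del: of_nat_Suc)
        show ?thesis unfolding e1 nk d using B k
          by (simp add: divide_simps right_diff_distrib)
      qed
      moreover have "real L / (real k * real (n choose k)) \<in> \<int>"
        using Suc.IH[of k] k Suc.prems(3) by auto
      moreover have "real L / (real (Suc k) * real (Suc n choose Suc k)) \<in> \<int>"
        using step.IH by (simp only: of_nat_mult)
      ultimately show ?case by (metis Ints_diff of_nat_mult)
    qed
  qed simp
  thus ?thesis using assms(2,3) by (subst (asm) dvd_iff) auto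
qed

text \<open>Nair's form of Chebyshev's bound: the average of \<open>k * (n choose k)\<close> over
  \<open>k = 1..n\<close> is \<open>2 ^ (n - 1)\<close>, and each of these numbers divides the least
  common multiple of 1, ..., n, whose prime powers are at most \<open>n\<close>.\<close>

lemma two_power_le_power_prime_count:
  assumes "n \<ge> 1"
  shows "2 ^ (n - 1) \<le> n ^ card {p. prime p \<and> p \<le> n}"
proof -
  define P where "P = {p. prime p \<and> p \<le> n}"
  have fin: "finite P" unfolding P_def by auto
  define L where "L = (\<Prod>p\<in>P. p ^ Max {e. p ^ e \<le> n})"
  have fe: "finite {e. p ^ e \<le> n}" if "p \<in> P" for p
  proof (rule finite_subset)
    have "2 \<le> p" using that prime_ge_2_nat by (auto simp: P_def)
    show "{e. p ^ e \<le> n} \<subseteq> {..n}"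
    proof safe
      fix e assume "p ^ e \<le> n"
      moreover have "e < p ^ e" using \<open>2 \<le> p\<close> by (intro power_gt_expt) auto
      ultimately show "e \<le> n" by linarith
    qed
  qed auto
  have i_dvd: "i dvd L" if "i \<in> {1..n}" for i
  proof -
    have "i = (\<Prod>p\<in>prime_factors i. p ^ multiplicity p i)"
      using that prime_factorization_nat[of i] by auto
    also have "\<dots> dvd (\<Prod>p\<in>prime_factors i. p ^ Max {e. p ^ e \<le> n})"
    proof (rule prod_dvd_prod)
      fix p assume p: "p \<in> prime_factors i"
      have "p \<in> P" using p that unfolding P_def by (auto dest!: dvd_imp_le simp: in_prime_factors_iff)
      have "p ^ multiplicity p i \<le> i"
        using that multiplicity_dvd[of p i] by (intro dvd_imp_le) auto
      hence "multiplicity p i \<le> Max {e. p ^ e \<le> n}" using that fe[OF \<open>p \<in> P\<close>]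
        by (intro Max_ge) auto
      thus "p ^ multiplicity p i dvd p ^ Max {e. p ^ e \<le> n}" by (rule le_imp_power_dvd)
    qed
    also have "\<dots> dvd L" unfolding L_def using that
      by (intro prod_dvd_prod_subset fin) (auto simp: P_def in_prime_factors_iff dest!: dvd_imp_le)
    finally show ?thesis .
  qed
  have Lle: "L \<le> n ^ card P"
    unfolding L_def
  proof (rule prod_le_power)
    fix p assume p: "p \<in> P"
    have "Max {e. p ^ e \<le> n} \<in> {e. p ^ e \<le> n}"
      using fe[OF p] assms by (intro Max_in) (auto intro: exI[of _ 0])
    thus "0 \<le> p ^ Max {e. p ^ e \<le> n} \<and> p ^ Max {e. p ^ e \<le> n} \<le> n" by simp
  qed (use assms in auto)
  have Lpos: "L > 0" unfolding L_def by (auto simp: P_def prime_gt_0_nat intro!: prod_pos)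
  have "n * 2 ^ (n - 1) = (\<Sum>k\<le>n. k * (n choose k))" by (simp add: choose_linear_sum)
  also have "\<dots> = (\<Sum>k=1..n. k * (n choose k))"
    by (intro sum.mono_neutral_right) auto
  also have "\<dots> \<le> (\<Sum>k=1..n. L)"
    using mult_binomial_dvd[OF i_dvd] Lpos by (intro sum_mono dvd_imp_le) auto
  finally have "n * 2 ^ (n - 1) \<le> n * L" by simp
  hence "2 ^ (n - 1) \<le> L" using assms by simp
  with Lle show ?thesis unfolding P_def by linarith
qed

section \<open>Primes modulo which \<open>b\<close> has small order\<close>

lemma card_prime_divisors_le:
  fixes m k :: nat
  assumes "m > 0" "m \<le> 2 ^ k"
  shows "card {p. prime p \<and> p dvd m} \<le> k"
proof -
  have "{p. prime p \<and> p dvd m} = prime_factors m" using assms by (auto simp: in_prime_factors_iff)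
  moreover have "2 ^ card (prime_factors m) \<le> m"
  proof -
    have "2 ^ card (prime_factors m) = (\<Prod>p\<in>prime_factors m. 2)" by simp
    also have "\<dots> \<le> (\<Prod>p\<in>prime_factors m. p)"
      by (intro prod_mono) (auto simp: in_prime_factors_iff prime_ge_2_nat)
    also have "\<dots> \<le> (\<Prod>p\<in>prime_factors m. p ^ multiplicity p m)"
    proof (intro prod_mono conjI)
      fix p assume p: "p \<in> prime_factors m"
      have "multiplicity p m \<ge> 1" using p by (simp add: prime_factors_multiplicity)
      thus "p \<le> p ^ multiplicity p m" using p
        by (intro self_le_power) (auto simp: prime_gt_0_nat in_prime_factors_iff Suc_le_eq)
    qed simp
    also have "\<dots> = m" using prime_factorization_nat[of m] assms by simp
    finally show ?thesis .
  qed
  ultimately have "(2::nat) ^ card {p. prime p \<and> p dvd m} \<le> 2 ^ k"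
    using assms(2) by (metis order_trans)
  thus ?thesis by (subst (asm) power_increasing_iff) auto
qed

lemma card_primes_dvd_power_minus_one_le:
  fixes b m :: nat
  assumes "b \<ge> 2"
  shows "finite {p. prime p \<and> (\<exists>n\<in>{1..m}. p dvd b ^ n - 1)}"
    and "card {p. prime p \<and> (\<exists>n\<in>{1..m}. p dvd b ^ n - 1)} \<le> b * m\<^sup>2"
proof -
  have pos: "b ^ n - 1 > 0" if "n \<in> {1..m}" for n
    using that assms one_less_power[of b n] by auto
  have eq: "{p. prime p \<and> (\<exists>n\<in>{1..m}. p dvd b ^ n - 1)}
      = (\<Union>n\<in>{1..m}. {p. prime p \<and> p dvd b ^ n - 1})" by blast
  have fin: "finite {p. prime p \<and> p dvd b ^ n - 1}" if "n \<in> {1..m}" for n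
    using pos[OF that] finite_divisors_nat[of "b ^ n - 1"] by (auto elim: finite_subset[rotated])
  thus "finite {p. prime p \<and> (\<exists>n\<in>{1..m}. p dvd b ^ n - 1)}" unfolding eq by blast
  have "card {p. prime p \<and> (\<exists>n\<in>{1..m}. p dvd b ^ n - 1)}
      \<le> (\<Sum>n=1..m. card {p. prime p \<and> p dvd b ^ n - 1})"
    unfolding eq by (rule card_UN_le) simp
  also have "\<dots> \<le> (\<Sum>n=1..m. b * m)"
  proof (rule sum_mono)
    fix n assume n: "n \<in> {1..m}"
    \<comment> \<open>The crude bound \<open>b \<le> 2 ^ b\<close> stands in for a logarithm; it
      costs only a factor depending on \<open>b\<close>.\<close>
    have "b ^ n \<le> (2 ^ b) ^ n" by (intro power_mono) (auto intro: less_imp_le less_exp)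
    hence "b ^ n - 1 \<le> 2 ^ (b * n)" by (simp add: power_mult)
    hence "card {p. prime p \<and> p dvd b ^ n - 1} \<le> b * n"
      using pos[OF n] by (intro card_prime_divisors_le)
    also have "\<dots> \<le> b * m" using n by simp
    finally show "card {p. prime p \<and> p dvd b ^ n - 1} \<le> b * m" .
  qed
  finally show "card {p. prime p \<and> (\<exists>n\<in>{1..m}. p dvd b ^ n - 1)} \<le> b * m\<^sup>2"
    by (simp add: power2_eq_square algebra_simps)
qed

section \<open>Density of the integers coprime to \<open>N\<close> and not divisible by
  \<open>a\<close>\<close>

lemma card_coprime_interval:
  assumes "N > 0"
  shows "card {t\<in>{1..N * M}. coprime t N} = totient N * M"
proof (induction M)
  case (Suc M)
  have "{t\<in>{1..N * Suc M}. coprime t N}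
      = {t\<in>{1..N * M}. coprime t N} \<union> (\<lambda>t. t + N * M) ` totatives N"
  proof (intro equalityI subsetI)
    fix t assume t: "t \<in> {t\<in>{1..N * Suc M}. coprime t N}"
    show "t \<in> {t\<in>{1..N * M}. coprime t N} \<union> (\<lambda>t. t + N * M) ` totatives N"
    proof (cases "t \<le> N * M")
      case False
      define s where "s = t - N * M"
      have s: "t = s + N * M" using False by (simp add: s_def)
      hence "coprime s N" using t
        by (metis (no_types, lifting) coprime_iff_gcd_eq_1 gcd_add_mult mem_Collect_eq add.commute gcd.commute mult.commute)
      moreover have "s > 0" "s \<le> N" using False t s by auto
      ultimately show ?thesis using s by (auto simp: totatives_def)
    qed (use t in auto)
  next
    fix t assume "t \<in> {t\<in>{1..N * M}. coprime t N} \<union> (\<lambda>t. t + N * M) ` totatives N"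
    moreover have "coprime (s + N * M) N" if "coprime s N" for s
      using that by (metis coprime_iff_gcd_eq_1 gcd.commute gcd_add_mult add.commute mult.commute)
    ultimately show "t \<in> {t\<in>{1..N * Suc M}. coprime t N}" by (auto simp: totatives_def)
  qed
  moreover have "card (\<dots>) = totient N * M + totient N"
    using Suc.IH
    by (subst card_Un_disjoint) (auto simp: card_image inj_on_def totient_def totatives_def)
  ultimately show ?case by simp
qed auto

text \<open>Since \<open>a\<close> is coprime to \<open>N\<close>, multiplication by
  \<open>a\<close> maps the integers coprime to \<open>N\<close> up to \<open>N * M\<close> into
  those up to \<open>N * (a * M)\<close>, and all images are removed. Rounding \<open>n\<close> up
  to full periods of length \<open>N * a\<close> costs the summand 1.\<close>

lemma card_coprime_not_dvd_le:
  fixes a N n :: nat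
  assumes N: "N > 0" and a: "a > 0" "coprime a N"
  shows "card {t\<in>{1..n}. coprime t N \<and> \<not> a dvd t} \<le> totient N * (a - 1) * (n div (N * a) + 1)"
proof -
  define M where "M = n div (N * a) + 1"
  have "n < N * a * M" unfolding M_def using N a
    by (simp add: dividend_less_times_div)
  hence nle: "n \<le> N * (a * M)" by (simp add: mult.assoc)
  let ?S = "{t\<in>{1..N * (a * M)}. coprime t N}" and ?T = "{s\<in>{1..N * M}. coprime s N}"
  have sub: "(\<lambda>s. a * s) ` ?T \<subseteq> ?S" using a by auto
  have "card {t\<in>{1..n}. coprime t N \<and> \<not> a dvd t} \<le> card (?S - (\<lambda>s. a * s) ` ?T)"
    using nle by (intro card_mono) auto
  also have "\<dots> = card ?S - card ((\<lambda>s. a * s) ` ?T)"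
    using sub by (intro card_Diff_subset) (auto intro: finite_subset)
  also have "card ((\<lambda>s. a * s) ` ?T) = card ?T" using a by (intro card_image) (auto simp: inj_on_def)
  also have "card ?S - card ?T = totient N * (a * M) - totient N * M"
    using card_coprime_interval[OF N] by simp
  also have "\<dots> = totient N * (a - 1) * M" by (simp add: algebra_simps diff_mult_distrib2)
  finally show ?thesis unfolding M_def .
qed

lemma Limsup_coprime_not_dvd_le:
  fixes a N :: nat and G :: "real set"
  assumes N: "N > 0" and a: "a > 0" "coprime a N"
    and G: "G \<subseteq> real ` {t. t > 0 \<and> coprime t N \<and> \<not> a dvd t}"
  shows "Limsup at_top (\<lambda>x :: real. num_elements (G \<inter> {0..x}) / ennreal x)
    \<le> ennreal ((1 - 1 / real a) * (real (totient N) / real N))"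
proof -
  let ?L = "(1 - 1 / real a) * (real (totient N) / real N)"
  \<comment> \<open>The second summand is the rounding error, the count in one full period, divided
    by \<open>x\<close>.\<close>
  define g where "g x = ?L + real (totient N * (a - 1)) / x" for x :: real
  have bound: "num_elements (G \<inter> {0..x}) / ennreal x \<le> ennreal (g x)" if x: "x > 0" for x
  proof -
    define n where "n = nat \<lfloor>x\<rfloor>"
    let ?A = "{t\<in>{1..n}. coprime t N \<and> \<not> a dvd t}"
    have n: "real n \<le> x" using x by (simp add: n_def)
    have "G \<inter> {0..x} \<subseteq> real ` ?A"
    proof
      fix r assume r: "r \<in> G \<inter> {0..x}"
      with G obtain t where t: "r = real t" "t > 0" "coprime t N" "\<not> a dvd t" by auto
      hence "t \<le> n" using r by (auto simp: n_def le_nat_iff le_floor_iff)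
      thus "r \<in> real ` ?A" using t by auto
    qed
    hence fin: "finite (G \<inter> {0..x})" and le: "card (G \<inter> {0..x}) \<le> card (real ` ?A)"
      by (auto intro: finite_subset card_mono)
    note le
    also have "\<dots> \<le> card ?A" by (rule card_image_le) simp
    also have "\<dots> \<le> totient N * (a - 1) * (n div (N * a) + 1)"
      using card_coprime_not_dvd_le[OF N a] .
    finally have "real (card (G \<inter> {0..x})) \<le> real (totient N * (a - 1) * (n div (N * a) + 1))"
      by (simp only: of_nat_le_iff)
    also have "\<dots> = real (totient N * (a - 1)) * (real (n div (N * a)) + 1)"
      by (simp only: of_nat_mult of_nat_add of_nat_1)
    also have "\<dots> \<le> real (totient N * (a - 1)) * (x / real (N * a) + 1)"
    proof -
      have "real (n div (N * a)) \<le> real n / real (N * a)" by (rule of_nat_div_le_of_nat)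
      also have "\<dots> \<le> x / real (N * a)" using n by (intro divide_right_mono) auto
      finally show ?thesis by (intro mult_left_mono) auto
    qed
    also have "\<dots> = g x * x"
      using a N x by (simp add: g_def field_simps of_nat_diff)
    finally have "real (card (G \<inter> {0..x})) / x \<le> g x" using x by (simp add: field_simps)
    moreover have "num_elements (G \<inter> {0..x}) / ennreal x = ennreal (real (card (G \<inter> {0..x})) / x)"
      using fin x by (simp add: num_elements_def emeasure_count_space divide_ennreal ennreal_of_nat_eq_real_of_nat)
    ultimately show ?thesis by (simp add: ennreal_leI)
  qed
  have "(g \<longlongrightarrow> ?L + 0) at_top"
    unfolding g_def by (intro tendsto_add tendsto_const tendsto_divide_0[OF tendsto_const] filterlim_ident filterlim_at_top_imp_at_infinity)
  hence lim: "((\<lambda>x. ennreal (g x)) \<longlongrightarrow> ennreal ?L) at_top" by simp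
  have "Limsup at_top (\<lambda>x. num_elements (G \<inter> {0..x}) / ennreal x) \<le> Limsup at_top (\<lambda>x. ennreal (g x))"
    by (intro Limsup_mono eventually_mono[OF eventually_gt_at_top[of 0]] bound)
  also have "\<dots> = ennreal ?L" using lim by (intro lim_imp_Limsup) auto
  finally show ?thesis .
qed

section \<open>Exceptional primes against all primes\<close>

lemma prime_count_power_ge:
  fixes b j :: nat
  assumes "b \<ge> 2"
  shows "b ^ j - 1 \<le> card {p. prime p \<and> p \<le> b ^ j} * (j * b)"
proof -
  let ?c = "card {p. prime p \<and> p \<le> b ^ j}"
  have "(2::nat) ^ (b ^ j - 1) \<le> (b ^ j) ^ ?c"
    using assms by (intro two_power_le_power_prime_count) auto
  also have "\<dots> \<le> ((2 ^ b) ^ j) ^ ?c"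
    by (intro power_mono) (auto intro: less_imp_le less_exp)
  also have "\<dots> = 2 ^ (?c * (j * b))" by (simp only: power_mult[symmetric] mult_ac)
  finally show ?thesis by simp
qed

text \<open>Chebyshev's bound gives about \<open>b ^ j / (j * b)\<close> primes up to
  \<open>b ^ j\<close>, against at most \<open>C * N ^ (2 * (j + 1))\<close> exceptions up to
  \<open>b ^ (j + 1)\<close>. Bracketing \<open>x\<close> between consecutive powers of
  \<open>b\<close> loses only constant factors, which \<open>N\<^sup>2 < b\<close> makes
  negligible.\<close>

lemma Liminf_primes_ge_1:
  fixes b N C :: nat and G :: "real set"
  assumes b: "N\<^sup>2 < b" "b \<ge> 2"
    and G: "\<And>k. card {p. prime p \<and> p \<le> b ^ k \<and> real p \<notin> G} \<le> C * N ^ (2 * k)"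
  shows "Liminf at_top (\<lambda>x :: real. num_elements (G \<inter> {0..x}) / ennreal (real (prime_count x))) \<ge> 1"
proof (subst le_Liminf_iff, intro allI impI)
  fix y :: ennreal assume "y < 1"
  then obtain r where r: "y = ennreal r" "0 \<le> r" "r < 1"
    by (cases y) (auto simp: ennreal_less_iff simp flip: ennreal_1)
  define e where "e = 1 - r"
  have e: "e > 0" using r by (simp add: e_def)
  let ?\<rho> = "real (N\<^sup>2) / real b"
  \<comment> \<open>This is the inequality \<open>J'\<close> below divided by \<open>b ^ j\<close>:
    the bracket splits the factor \<open>j + 1\<close>, and the last summand comes from the -1 in
    \<open>b ^ j - 1\<close>.\<close>
  have "(\<lambda>j. real (C * N\<^sup>2 * b) * (real j * ?\<rho> ^ j + ?\<rho> ^ j) + e * (1 / real b) ^ j)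
      \<longlonglongrightarrow> real (C * N\<^sup>2 * b) * (0 + 0) + e * 0"
    using b by (intro tendsto_intros powser_times_n_limit_0 LIMSEQ_realpow_zero) (auto simp flip: of_nat_power)
  hence "eventually (\<lambda>j. real (C * N\<^sup>2 * b) * (real j * ?\<rho> ^ j + ?\<rho> ^ j) + e * (1 / real b) ^ j < e) sequentially"
    using e by (intro order_tendstoD(2)) auto
  then obtain J where J: "\<And>j. j \<ge> J \<Longrightarrow>
      real (C * N\<^sup>2 * b) * (real j * ?\<rho> ^ j + ?\<rho> ^ j) + e * (1 / real b) ^ j < e"
    unfolding eventually_sequentially by blast
  have J': "real (C * N ^ (2 * (j + 1))) * (real j + 1) * real b < e * (real b ^ j - 1)" if "j \<ge> J" for j
  proof -
    have "(real (C * N\<^sup>2 * b) * (real j * ?\<rho> ^ j + ?\<rho> ^ j) + e * (1 / real b) ^ j) * real b ^ j < e * real b ^ j"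
      using J[OF that] b by (intro mult_strict_right_mono) auto
    also have "(real (C * N\<^sup>2 * b) * (real j * ?\<rho> ^ j + ?\<rho> ^ j) + e * (1 / real b) ^ j) * real b ^ j
        = real (C * N\<^sup>2 * b) * (real j + 1) * real (N\<^sup>2) ^ j + e"
      using b by (simp add: power_divide field_simps)
    finally show ?thesis by (simp add: power_add power_mult algebra_simps power2_eq_square)
  qed
  have main: "y < num_elements (G \<inter> {0..x}) / ennreal (real (prime_count x))" if x: "x \<ge> real b ^ J" "x \<ge> 2" for x
  proof -
    define n where "n = nat \<lfloor>x\<rfloor>"
    have le_n: "real p \<le> x \<longleftrightarrow> p \<le> n" for p :: nat using x by (auto simp: n_def le_nat_iff le_floor_iff)
    have "b ^ J \<le> n" using x le_n[of "b ^ J"] by simp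
    obtain j where j: "b ^ j \<le> n" "n < b ^ (j + 1)"
      using ex_power_ivl1[of b n] \<open>b ^ J \<le> n\<close> b by (metis One_nat_def Suc_leI less_le_trans zero_less_power pos2)
    have "b ^ J < b ^ (j + 1)" using \<open>b ^ J \<le> n\<close> j by linarith
    hence "j \<ge> J" using b by (subst (asm) power_strict_increasing_iff) auto
    define P where "P = {p. prime p \<and> p \<le> n}"
    define Bad where "Bad = {p. prime p \<and> p \<le> n \<and> real p \<notin> G}"
    have finP: "finite P" unfolding P_def by auto
    have "Bad \<subseteq> P" unfolding Bad_def P_def by auto
    have "card Bad \<le> card {p. prime p \<and> p \<le> b ^ (j + 1) \<and> real p \<notin> G}"
      unfolding Bad_def using j by (intro card_mono) auto
    also have "\<dots> \<le> C * N ^ (2 * (j + 1))" by (rule G)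
    finally have "real (card Bad) * (real j + 1) * real b \<le> real (C * N ^ (2 * (j + 1))) * (real j + 1) * real b"
      by (intro mult_right_mono) (auto simp only: of_nat_le_iff)
    also have "\<dots> < e * (real b ^ j - 1)" by (rule J'[OF \<open>j \<ge> J\<close>])
    also have "\<dots> \<le> e * (real (card P) * (real j + 1) * real b)"
    proof -
      have "b ^ j - 1 \<le> card {p. prime p \<and> p \<le> b ^ j} * (j * b)"
        using prime_count_power_ge b by simp
      also have "\<dots> \<le> card P * ((j + 1) * b)"
        using j finP by (intro mult_mono card_mono) (auto simp: P_def)
      finally have "real (b ^ j - 1) \<le> real (card P * ((j + 1) * b))" by (simp only: of_nat_le_iff)
      moreover have "real (b ^ j - 1) = real b ^ j - 1" using b by (simp add: of_nat_diff)
      ultimately have "real b ^ j - 1 \<le> real (card P) * (real j + 1) * real b" by (simp add: algebra_simps)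
      thus ?thesis using e by (intro mult_left_mono) auto
    qed
    finally have "real (card Bad) * ((real j + 1) * real b) < e * real (card P) * ((real j + 1) * real b)"
      by (simp add: mult.assoc)
    hence bad: "real (card Bad) < e * real (card P)"
      by (rule mult_right_less_imp_less) auto
    hence P0: "card P > 0" by (cases "card P") auto
    have pc: "prime_count x = card P" unfolding prime_count_def P_def le_n ..
    have sub: "real ` (P - Bad) \<subseteq> G \<inter> {0..x}"
      by (auto simp: P_def Bad_def le_n)
    have "r * real (card P) < real (card P) - real (card Bad)" using bad by (simp add: e_def algebra_simps)
    also have "\<dots> = real (card (real ` (P - Bad)))"
      using \<open>Bad \<subseteq> P\<close> finP card_mono[OF finP \<open>Bad \<subseteq> P\<close>]
      by (simp add: card_image card_Diff_subset finite_subset of_nat_diff)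
    finally have lt: "r < real (card (real ` (P - Bad))) / real (card P)" using P0 by (simp add: field_simps)
    have "y < ennreal (real (card (real ` (P - Bad))) / real (card P))"
      unfolding r(1) using lt r(2) by (subst ennreal_less_iff) auto
    also have "\<dots> = num_elements (real ` (P - Bad)) / ennreal (real (card P))"
      using finP P0 by (simp add: num_elements_def emeasure_count_space divide_ennreal ennreal_of_nat_eq_real_of_nat)
    also have "\<dots> \<le> num_elements (G \<inter> {0..x}) / ennreal (real (prime_count x))"
      unfolding pc num_elements_def by (intro divide_right_mono_ennreal emeasure_mono sub) auto
    finally show ?thesis .
  qed
  show "\<forall>\<^sub>F x in at_top. y < num_elements (G \<inter> {0..x}) / ennreal (real (prime_count x))"
    using eventually_ge_at_top[of "real b ^ J"] eventually_ge_at_top[of 2]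
    by eventually_elim (rule main)
qed

section \<open>Closed linear span of exponentials\<close>

lemma norm_expo [simp]: "cmod (expo l x) = 1"
  by (simp add: expo_def norm_exp_eq_Re)

lemma expo_0 [simp]: "expo 0 x = 1" "expo l 0 = 1"
  by (simp_all add: expo_def)

lemma expo_add_left: "expo (l + m) x = expo l x * expo m x"
  by (simp add: expo_def ring_distribs flip: exp_add)

lemma expo_add_right: "expo l (x + y) = expo l x * expo l y"
  by (simp add: expo_def ring_distribs flip: exp_add)

lemma cnj_expo: "cnj (expo l x) = expo (- l) x"
  by (simp add: expo_def exp_cnj)

lemma continuous_on_expo [continuous_intros]: "continuous_on A (expo l)"
  unfolding expo_def by (intro continuous_intros)

lemma borel_measurable_expo [measurable]: "expo l \<in> borel_measurable borel"
  by (intro borel_measurable_continuous_onI continuous_intros)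

lemma norm_add_square_le: "(cmod (a + b))\<^sup>2 \<le> 2 * (cmod a)\<^sup>2 + 2 * (cmod b)\<^sup>2"
proof -
  have "(cmod (a + b))\<^sup>2 \<le> (cmod a + cmod b)\<^sup>2" by (intro power_mono norm_triangle_ineq) auto
  also have "\<dots> \<le> 2 * (cmod a)\<^sup>2 + 2 * (cmod b)\<^sup>2"
    using zero_le_power2[of "cmod a - cmod b"] by (simp add: power2_eq_square algebra_simps)
  finally show ?thesis .
qed

text \<open>The closed linear span of the exponentials in L2, described by representatives as in
  \<open>total_exponentials\<close>, which asserts that every square integrable function belongs to
  it.\<close>

definition exp_closure :: "real measure \<Rightarrow> real set \<Rightarrow> (real \<Rightarrow> complex) set" where
  "exp_closure \<mu> \<Lambda> = {f. square_integrable \<mu> f \<and>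
     (\<forall>\<epsilon>>0. \<exists>F u. finite F \<and> F \<subseteq> \<Lambda> \<and>
        (\<integral>x. (cmod (f x - (\<Sum>l\<in>F. u l * expo l x)))\<^sup>2 \<partial>\<mu>) < \<epsilon>)}"

text \<open>The frequencies are arbitrary reals, not confined to the spectrum, so that products stay
  in the class and Stone-Weierstrass applies.\<close>

inductive trig_poly :: "(real \<Rightarrow> complex) \<Rightarrow> bool" where
  monom: "trig_poly (\<lambda>x. a * expo l x)"
| add: "trig_poly f \<Longrightarrow> trig_poly g \<Longrightarrow> trig_poly (\<lambda>x. f x + g x)"

lemma trig_poly_mult:
  assumes "trig_poly f" "trig_poly g"
  shows "trig_poly (\<lambda>x. f x * g x)"
  using assms
proof (induction f)
  case (monom a l)
  from monom show ?case
  proof (induction g)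
    case (monom c m)
    show ?case using trig_poly.monom[of "a * c" "l + m"] by (simp add: expo_add_left mult_ac)
  next
    case (add f g)
    thus ?case using trig_poly.add[OF add.IH] by (simp add: ring_distribs)
  qed
next
  case (add f g')
  show ?case using trig_poly.add[OF add.IH[OF add.prems]] by (simp add: ring_distribs)
qed

lemma trig_poly_continuous: "trig_poly f \<Longrightarrow> continuous_on A f"
  by (induction rule: trig_poly.induct) (auto intro!: continuous_intros)

lemma trig_poly_sin: "trig_poly (\<lambda>x. complex_of_real (sin (a * x)))"
proof -
  have "complex_of_real (sin (a * x)) =
      (\<i> / 2) * expo (a / (2 * pi)) x + (- \<i> / 2) * expo (- (a / (2 * pi))) x" for x
    by (simp add: expo_def sin_of_real[symmetric] sin_exp_eq field_simps)
  thus ?thesis by (simp only: trig_poly.add[OF trig_poly.monom trig_poly.monom])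
qed

text \<open>Stone-Weierstrass for the algebra of real functions whose complexification is a
  trigonometric polynomial; the sines among them separate points.\<close>

lemma trig_poly_approx:
  fixes g :: "real \<Rightarrow> real"
  assumes "continuous_on K g" "compact K" "\<epsilon> > 0"
  obtains h where "trig_poly h" "\<And>x. x \<in> K \<Longrightarrow> cmod (complex_of_real (g x) - h x) < \<epsilon>"
proof -
  define R where "R = {h :: real \<Rightarrow> real. trig_poly (\<lambda>x. complex_of_real (h x))}"
  interpret function_ring_on R K
  proof
    show "compact K" by fact
    show "continuous_on K f" if "f \<in> R" for f
    proof -
      have "continuous_on K (\<lambda>x. Re (complex_of_real (f x)))"
        using that unfolding R_def by (intro continuous_intros trig_poly_continuous) auto
      thus ?thesis by simp
    qed
    show "(\<lambda>x. f x + g x) \<in> R" if "f \<in> R" "g \<in> R" for f g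
      using that trig_poly.add by (auto simp: R_def)
    show "(\<lambda>x. f x * g x) \<in> R" if "f \<in> R" "g \<in> R" for f g
      using that trig_poly_mult by (auto simp: R_def)
    show "(\<lambda>_. c) \<in> R" for c
      using trig_poly.monom[of "complex_of_real c" 0] by (auto simp: R_def)
    show "\<exists>f\<in>R. f x \<noteq> f y" if "x \<noteq> y" for x y :: real
    proof -
      \<comment> \<open>So small that \<open>a * x\<close> and \<open>a * y\<close> both lie in an
        interval on which the sine is injective.\<close>
      define a where "a = 1 / (1 + \<bar>x\<bar> + \<bar>y\<bar>)"
      have a: "a > 0" by (simp add: a_def)
      have small: "- (pi / 2) \<le> a * z" "a * z \<le> pi / 2" if "\<bar>z\<bar> \<le> \<bar>x\<bar> + \<bar>y\<bar>" for z
      proof -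
        have "\<bar>a * z\<bar> \<le> 1" using that by (simp add: a_def abs_mult)
        thus "- (pi / 2) \<le> a * z" "a * z \<le> pi / 2" using pi_ge_two by linarith+
      qed
      have "sin (a * x) \<noteq> sin (a * y)"
        using small[of x] small[of y] a that sin_inj_pi[of "a * x" "a * y"] by auto
      thus ?thesis using trig_poly_sin[of a] by (intro bexI[of _ "\<lambda>x. sin (a * x)"]) (auto simp: R_def)
    qed
  qed
  obtain h where h: "h \<in> R" "\<And>x. x \<in> K \<Longrightarrow> \<bar>g x - h x\<bar> < \<epsilon>"
    using Stone_Weierstrass_basic[OF assms(1,3)] by blast
  show thesis
  proof (rule that[of "\<lambda>x. complex_of_real (h x)"])
    show "cmod (complex_of_real (g x) - complex_of_real (h x)) < \<epsilon>" if "x \<in> K" for x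
      using h(2)[OF that] by (metis norm_of_real of_real_diff)
  qed (use h in \<open>auto simp: R_def\<close>)
qed

context real_distribution
begin

section \<open>The closed span in L2 of a probability measure on the line\<close>

lemma square_integrable_bounded:
  assumes "f \<in> borel_measurable borel" "\<And>x. cmod (f x) \<le> B"
  shows "square_integrable M f"
proof -
  have "f \<in> borel_measurable M" using assms(1) by simp
  moreover have "integrable M (\<lambda>x. (cmod (f x))\<^sup>2)"
    using assms by (intro integrable_const_bound[of _ "B\<^sup>2"]) (auto intro!: power_mono)
  ultimately show ?thesis by (simp add: square_integrable_def)
qed

lemma square_integrable_add:
  assumes "square_integrable M f" "square_integrable M g"
  shows "square_integrable M (\<lambda>x. f x + g x)"
proof -
  have [measurable]: "f \<in> borel_measurable M" "g \<in> borel_measurable M"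
    using assms by (auto simp: square_integrable_def)
  have "integrable M (\<lambda>x. (cmod (f x + g x))\<^sup>2)"
  proof (rule Bochner_Integration.integrable_bound)
    show "integrable M (\<lambda>x. 2 * (cmod (f x))\<^sup>2 + 2 * (cmod (g x))\<^sup>2)"
      using assms by (auto simp: square_integrable_def)
  qed (use norm_add_square_le in \<open>auto simp del: sum_power2_ge_zero\<close>)
  thus ?thesis by (simp add: square_integrable_def)
qed

lemma square_integrable_scale:
  "square_integrable M f \<Longrightarrow> square_integrable M (\<lambda>x. a * f x)"
  by (auto simp: square_integrable_def norm_mult power_mult_distrib)

lemma square_integrable_diff:
  assumes "square_integrable M f" "square_integrable M g"
  shows "square_integrable M (\<lambda>x. f x - g x)"
  using square_integrable_add[OF assms(1) square_integrable_scale[OF assms(2), of "-1"]] by simp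

lemma square_integrable_expo: "square_integrable M (expo l)"
  by (rule square_integrable_bounded[of _ 1]) auto

lemma square_integrable_sum:
  "finite F \<Longrightarrow> (\<And>l. l \<in> F \<Longrightarrow> square_integrable M (f l)) \<Longrightarrow> square_integrable M (\<lambda>x. \<Sum>l\<in>F. f l x)"
proof (induction F rule: finite_induct)
  case empty
  thus ?case by (simp add: square_integrable_def)
next
  case (insert l F)
  thus ?case using square_integrable_add[of "f l" "\<lambda>x. \<Sum>l\<in>F. f l x"] by simp
qed

lemma square_integrable_exp_sum:
  "finite F \<Longrightarrow> square_integrable M (\<lambda>x. \<Sum>l\<in>F. u l * expo l x)"
  by (intro square_integrable_sum square_integrable_scale square_integrable_expo)

lemma integral_norm_add_square_le:
  assumes "square_integrable M f" "square_integrable M g"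
  shows "(\<integral>x. (cmod (f x + g x))\<^sup>2 \<partial>M) \<le> 2 * (\<integral>x. (cmod (f x))\<^sup>2 \<partial>M) + 2 * (\<integral>x. (cmod (g x))\<^sup>2 \<partial>M)"
proof -
  have "(\<integral>x. (cmod (f x + g x))\<^sup>2 \<partial>M) \<le> (\<integral>x. 2 * (cmod (f x))\<^sup>2 + 2 * (cmod (g x))\<^sup>2 \<partial>M)"
    using assms square_integrable_add[OF assms]
    by (intro integral_mono norm_add_square_le) (auto simp: square_integrable_def)
  thus ?thesis using assms by (simp add: square_integrable_def)
qed

lemma exp_closure_limit:
  assumes f: "square_integrable M f"
    and approx: "\<And>\<epsilon>. \<epsilon> > 0 \<Longrightarrow> \<exists>g\<in>exp_closure M \<Lambda>. (\<integral>x. (cmod (f x - g x))\<^sup>2 \<partial>M) < \<epsilon>"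
  shows "f \<in> exp_closure M \<Lambda>"
  unfolding exp_closure_def
proof (intro CollectI conjI allI impI f)
  fix \<epsilon> :: real assume e: "\<epsilon> > 0"
  \<comment> \<open>A quarter, because the squared norm of a sum is bounded by twice the sum of the
    squared norms.\<close>
  obtain g where g: "g \<in> exp_closure M \<Lambda>" "(\<integral>x. (cmod (f x - g x))\<^sup>2 \<partial>M) < \<epsilon> / 4"
    using approx[of "\<epsilon> / 4"] e by auto
  then obtain F u where F: "finite F" "F \<subseteq> \<Lambda>"
      "(\<integral>x. (cmod (g x - (\<Sum>l\<in>F. u l * expo l x)))\<^sup>2 \<partial>M) < \<epsilon> / 4"
    using e unfolding exp_closure_def by (auto dest!: spec[of _ "\<epsilon> / 4"])
  have gi: "square_integrable M g" using g by (simp add: exp_closure_def)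
  have "(\<integral>x. (cmod (f x - (\<Sum>l\<in>F. u l * expo l x)))\<^sup>2 \<partial>M)
      = (\<integral>x. (cmod ((f x - g x) + (g x - (\<Sum>l\<in>F. u l * expo l x))))\<^sup>2 \<partial>M)" by simp
  also have "\<dots> \<le> 2 * (\<integral>x. (cmod (f x - g x))\<^sup>2 \<partial>M)
      + 2 * (\<integral>x. (cmod (g x - (\<Sum>l\<in>F. u l * expo l x)))\<^sup>2 \<partial>M)"
    by (intro integral_norm_add_square_le square_integrable_diff f gi square_integrable_exp_sum F)
  also have "\<dots> < \<epsilon>" using g F by simp
  finally show "\<exists>F u. finite F \<and> F \<subseteq> \<Lambda> \<and> (\<integral>x. (cmod (f x - (\<Sum>l\<in>F. u l * expo l x)))\<^sup>2 \<partial>M) < \<epsilon>"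
    using F by blast
qed

lemma exp_closure_add:
  assumes f: "f \<in> exp_closure M \<Lambda>" and g: "g \<in> exp_closure M \<Lambda>"
  shows "(\<lambda>x. f x + g x) \<in> exp_closure M \<Lambda>"
  unfolding exp_closure_def
proof (intro CollectI conjI allI impI)
  have fi: "square_integrable M f" and gi: "square_integrable M g"
    using f g by (auto simp: exp_closure_def)
  show "square_integrable M (\<lambda>x. f x + g x)" by (rule square_integrable_add[OF fi gi])
  fix \<epsilon> :: real assume e: "\<epsilon> > 0"
  obtain F u where F: "finite F" "F \<subseteq> \<Lambda>"
      "(\<integral>x. (cmod (f x - (\<Sum>l\<in>F. u l * expo l x)))\<^sup>2 \<partial>M) < \<epsilon> / 4"
    using e f unfolding exp_closure_def by (auto dest!: spec[of _ "\<epsilon> / 4"])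
  obtain G v where G: "finite G" "G \<subseteq> \<Lambda>"
      "(\<integral>x. (cmod (g x - (\<Sum>l\<in>G. v l * expo l x)))\<^sup>2 \<partial>M) < \<epsilon> / 4"
    using e g unfolding exp_closure_def by (auto dest!: spec[of _ "\<epsilon> / 4"])
  define w where "w l = (if l \<in> F then u l else 0) + (if l \<in> G then v l else 0)" for l
  have w: "(\<Sum>l\<in>F \<union> G. w l * expo l x) = (\<Sum>l\<in>F. u l * expo l x) + (\<Sum>l\<in>G. v l * expo l x)" for x
  proof -
    have "(\<Sum>l\<in>F \<union> G. w l * expo l x) = (\<Sum>l\<in>F \<union> G. if l \<in> F then u l * expo l x else 0)
        + (\<Sum>l\<in>F \<union> G. if l \<in> G then v l * expo l x else 0)"
      unfolding w_def by (simp add: sum.distrib[symmetric] ring_distribs if_distrib[of "\<lambda>a. a * _"] cong: if_cong)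
    also have "\<dots> = (\<Sum>l\<in>F. u l * expo l x) + (\<Sum>l\<in>G. v l * expo l x)"
      using F G by (simp flip: sum.inter_restrict add: Int_absorb1 Int_absorb2)
    finally show ?thesis .
  qed
  have "(\<integral>x. (cmod (f x + g x - (\<Sum>l\<in>F \<union> G. w l * expo l x)))\<^sup>2 \<partial>M)
      = (\<integral>x. (cmod ((f x - (\<Sum>l\<in>F. u l * expo l x)) + (g x - (\<Sum>l\<in>G. v l * expo l x))))\<^sup>2 \<partial>M)"
    unfolding w by (simp add: algebra_simps)
  also have "\<dots> \<le> 2 * (\<integral>x. (cmod (f x - (\<Sum>l\<in>F. u l * expo l x)))\<^sup>2 \<partial>M)
      + 2 * (\<integral>x. (cmod (g x - (\<Sum>l\<in>G. v l * expo l x)))\<^sup>2 \<partial>M)"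
    by (intro integral_norm_add_square_le square_integrable_diff fi gi square_integrable_exp_sum F G)
  also have "\<dots> < \<epsilon>" using F G by simp
  finally show "\<exists>F u. finite F \<and> F \<subseteq> \<Lambda> \<and> (\<integral>x. (cmod (f x + g x - (\<Sum>l\<in>F. u l * expo l x)))\<^sup>2 \<partial>M) < \<epsilon>"
    using F G by (intro exI[of _ "F \<union> G"] exI[of _ w]) auto
qed

lemma exp_closure_scale:
  assumes f: "f \<in> exp_closure M \<Lambda>"
  shows "(\<lambda>x. a * f x) \<in> exp_closure M \<Lambda>"
proof (cases "a = 0")
  case True
  show ?thesis unfolding exp_closure_def True
    by (auto intro!: exI[of _ "{}"] simp: square_integrable_def)
next
  case a: False
  show ?thesis
    unfolding exp_closure_def
  proof (intro CollectI conjI allI impI)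
    show "square_integrable M (\<lambda>x. a * f x)"
      using f by (intro square_integrable_scale) (auto simp: exp_closure_def)
    fix \<epsilon> :: real assume e: "\<epsilon> > 0"
    hence "\<epsilon> / (cmod a)\<^sup>2 > 0" using a by simp
    then obtain F u where F: "finite F" "F \<subseteq> \<Lambda>"
        "(\<integral>x. (cmod (f x - (\<Sum>l\<in>F. u l * expo l x)))\<^sup>2 \<partial>M) < \<epsilon> / (cmod a)\<^sup>2"
      using f unfolding exp_closure_def by blast
    have "a * f x - (\<Sum>l\<in>F. (a * u l) * expo l x) = a * (f x - (\<Sum>l\<in>F. u l * expo l x))" for x
      by (simp add: sum_distrib_left mult.assoc right_diff_distrib)
    hence "(\<integral>x. (cmod (a * f x - (\<Sum>l\<in>F. (a * u l) * expo l x)))\<^sup>2 \<partial>M)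
        = (\<integral>x. (cmod a)\<^sup>2 * (cmod (f x - (\<Sum>l\<in>F. u l * expo l x)))\<^sup>2 \<partial>M)"
      by (simp only: norm_mult power_mult_distrib)
    also have "\<dots> = (cmod a)\<^sup>2 * (\<integral>x. (cmod (f x - (\<Sum>l\<in>F. u l * expo l x)))\<^sup>2 \<partial>M)"
      by simp
    also have "\<dots> < \<epsilon>" using F(3) a by (simp add: field_simps)
    finally show "\<exists>F u. finite F \<and> F \<subseteq> \<Lambda> \<and> (\<integral>x. (cmod (a * f x - (\<Sum>l\<in>F. u l * expo l x)))\<^sup>2 \<partial>M) < \<epsilon>"
      by (intro exI[of _ F] exI[of _ "\<lambda>l. a * u l"] conjI F(1,2))
  qed
qed

lemma exp_closure_zero: "(\<lambda>_. 0) \<in> exp_closure M \<Lambda>"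
  unfolding exp_closure_def by (auto intro!: exI[of _ "{}"] simp: square_integrable_def)

lemma exp_closure_sum:
  "finite I \<Longrightarrow> (\<And>i. i \<in> I \<Longrightarrow> f i \<in> exp_closure M \<Lambda>) \<Longrightarrow> (\<lambda>x. \<Sum>i\<in>I. f i x) \<in> exp_closure M \<Lambda>"
proof (induction I rule: finite_induct)
  case empty
  thus ?case by (simp add: exp_closure_zero)
next
  case (insert i I)
  thus ?case using exp_closure_add[of "f i" \<Lambda> "\<lambda>x. \<Sum>i\<in>I. f i x"] by simp
qed

lemma exp_closure_trig_poly:
  assumes "trig_poly f" "\<And>l. expo l \<in> exp_closure M \<Lambda>"
  shows "f \<in> exp_closure M \<Lambda>"
  using assms(1)
  by (induction rule: trig_poly.induct) (auto intro: exp_closure_add exp_closure_scale assms(2))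

text \<open>Pointwise convergence under a square integrable majorant is L2 convergence, the squared
  error being at most \<open>4 * (w x)\<^sup>2\<close>. This one passage carries the closure from
  continuous functions to indicators and from simple functions to arbitrary ones.\<close>

lemma exp_closure_dominated:
  assumes f: "f \<in> borel_measurable borel"
    and s: "\<And>n. s n \<in> exp_closure M \<Lambda>" "\<And>x. (\<lambda>n. s n x) \<longlonglongrightarrow> f x"
    and w: "integrable M (\<lambda>x. (w x)\<^sup>2)" "\<And>n x. cmod (s n x) \<le> w x"
  shows "f \<in> exp_closure M \<Lambda>"
proof -
  have fw: "cmod (f x) \<le> w x" for x
    using tendsto_norm[OF s(2)[of x]] w(2) by (intro LIMSEQ_le_const2) auto
  have w0: "0 \<le> w x" for x using fw[of x] norm_ge_zero order_trans by blast
  have [measurable]: "f \<in> borel_measurable M" using f by simp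
  have fi: "square_integrable M f"
    unfolding square_integrable_def
    by (intro conjI Bochner_Integration.integrable_bound[OF w(1)] AE_I2) (auto intro!: power_mono fw)
  have [measurable]: "s n \<in> borel_measurable M" for n
    using s(1)[of n] by (simp add: exp_closure_def square_integrable_def)
  have "(\<lambda>n. \<integral>x. (cmod (f x - s n x))\<^sup>2 \<partial>M) \<longlonglongrightarrow> (\<integral>x. 0 \<partial>M)"
  proof (rule integral_dominated_convergence)
    show "integrable M (\<lambda>x. 4 * (w x)\<^sup>2)" using w(1) by simp
    show "AE x in M. (\<lambda>n. (cmod (f x - s n x))\<^sup>2) \<longlonglongrightarrow> 0"
    proof (rule AE_I2)
      fix x
      have "(\<lambda>n. (cmod (f x - s n x))\<^sup>2) \<longlonglongrightarrow> (cmod (f x - f x))\<^sup>2"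
        by (intro tendsto_intros s(2))
      thus "(\<lambda>n. (cmod (f x - s n x))\<^sup>2) \<longlonglongrightarrow> 0" by simp
    qed
    show "AE x in M. norm ((cmod (f x - s n x))\<^sup>2) \<le> 4 * (w x)\<^sup>2" for n
    proof (rule AE_I2)
      fix x
      have "cmod (f x - s n x) \<le> 2 * w x" using norm_triangle_ineq4[of "f x" "s n x"] fw[of x] w(2)[of n x] by linarith
      hence "(cmod (f x - s n x))\<^sup>2 \<le> (2 * w x)\<^sup>2" by (intro power_mono) auto
      thus "norm ((cmod (f x - s n x))\<^sup>2) \<le> 4 * (w x)\<^sup>2" by (simp add: power_mult_distrib)
    qed
  qed auto
  hence lim: "(\<lambda>n. \<integral>x. (cmod (f x - s n x))\<^sup>2 \<partial>M) \<longlonglongrightarrow> 0" by simp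
  show ?thesis
  proof (rule exp_closure_limit[OF fi])
    fix \<epsilon> :: real assume "\<epsilon> > 0"
    from order_tendstoD(2)[OF lim this] obtain n where "(\<integral>x. (cmod (f x - s n x))\<^sup>2 \<partial>M) < \<epsilon>"
      by (meson eventually_happens trivial_limit_sequentially)
    thus "\<exists>g\<in>exp_closure M \<Lambda>. (\<integral>x. (cmod (f x - g x))\<^sup>2 \<partial>M) < \<epsilon>" using s(1) by blast
  qed
qed

text \<open>The complement of \<open>K\<close> is a null set, so uniform approximation on
  \<open>K\<close> is approximation in L2; the bound on \<open>g\<close> supplies square
  integrability on the whole line.\<close>

lemma exp_closure_continuous:
  fixes g :: "real \<Rightarrow> real"
  assumes K: "compact K" "measure M (- K) = 0" and ex: "\<And>l. expo l \<in> exp_closure M \<Lambda>"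
    and g: "continuous_on UNIV g" "\<And>x. \<bar>g x\<bar> \<le> B"
  shows "(\<lambda>x. complex_of_real (g x)) \<in> exp_closure M \<Lambda>"
proof (rule exp_closure_limit)
  have [measurable]: "g \<in> borel_measurable borel" by (rule borel_measurable_continuous_onI[OF g(1)])
  show gi: "square_integrable M (\<lambda>x. complex_of_real (g x))"
    using g(2) by (intro square_integrable_bounded[of _ B]) auto
  fix \<epsilon> :: real assume e: "\<epsilon> > 0"
  define d where "d = sqrt (\<epsilon> / 2)"
  have d: "d > 0" "d\<^sup>2 = \<epsilon> / 2" using e by (auto simp: d_def)
  obtain h where h: "trig_poly h" "\<And>x. x \<in> K \<Longrightarrow> cmod (complex_of_real (g x) - h x) < d"
    using trig_poly_approx[OF continuous_on_subset[OF g(1)] K(1) d(1)] by blast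
  have hc: "h \<in> exp_closure M \<Lambda>" by (rule exp_closure_trig_poly[OF h(1) ex])
  have "- K \<in> null_sets M"
    using K compact_imp_closed[of K] by (auto intro!: null_setsI simp: emeasure_eq_measure)
  hence ae: "AE x in M. x \<in> K" by (auto dest: AE_not_in)
  have "(\<integral>x. (cmod (complex_of_real (g x) - h x))\<^sup>2 \<partial>M) \<le> (\<integral>x. d\<^sup>2 \<partial>M)"
  proof (rule integral_mono_AE)
    show "integrable M (\<lambda>x. (cmod (complex_of_real (g x) - h x))\<^sup>2)"
      using square_integrable_diff[OF gi, of h] hc by (auto simp: exp_closure_def square_integrable_def)
    show "AE x in M. (cmod (complex_of_real (g x) - h x))\<^sup>2 \<le> d\<^sup>2"
      using ae by eventually_elim (intro power_mono less_imp_le[OF h(2)]; simp)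
  qed simp
  also have "\<dots> = \<epsilon> / 2" using prob_space d by simp
  also have "\<dots> < \<epsilon>" using e by simp
  finally show "\<exists>g'\<in>exp_closure M \<Lambda>. (\<integral>x. (cmod (complex_of_real (g x) - g' x))\<^sup>2 \<partial>M) < \<epsilon>"
    using hc by blast
qed

text \<open>Dynkin's pi-lambda argument from the half-lines: complements use the constant
  \<open>expo 0\<close>, countable disjoint unions use dominated convergence.\<close>

lemma exp_closure_indicator:
  fixes A :: "real set"
  assumes K: "compact K" "measure M (- K) = 0" and ex: "\<And>l. expo l \<in> exp_closure M \<Lambda>"
    and A: "A \<in> sets borel"
  shows "indicator A \<in> exp_closure M \<Lambda>"
proof -
  have "Int_stable (range (\<lambda>a::real. {..a}))" by (auto simp: Int_stable_def)
  moreover have "range (\<lambda>a::real. {..a}) \<subseteq> Pow UNIV" by auto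
  moreover have "A \<in> sigma_sets UNIV (range (\<lambda>a::real. {..a}))"
    using A by (simp add: borel_eq_atMost)
  ultimately show ?thesis
  proof (induction rule: sigma_sets_induct_disjoint)
    case (basic A)
    then obtain a where A: "A = {..a}" by auto
    \<comment> \<open>For \<open>n > 0\<close> a continuous ramp, equal to 1 up to \<open>a\<close>
      and to 0 from \<open>a + 1 / n\<close> on; it decreases to the indicator.\<close>
    define s where "s n x = max 0 (min 1 (1 - real n * (x - a)))" for n :: nat and x :: real
    show ?case
    proof (rule exp_closure_dominated[of _ "\<lambda>n x. complex_of_real (s n x)" _ "\<lambda>_. 1"])
      show "(\<lambda>x. complex_of_real (s n x)) \<in> exp_closure M \<Lambda>" for n
        by (rule exp_closure_continuous[OF K ex, where B = 1])
           (auto simp: s_def intro!: continuous_intros)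
      show "(\<lambda>n. complex_of_real (s n x)) \<longlonglongrightarrow> indicator A x" for x
      proof (cases "x \<le> a")
        case True
        hence "s n x = 1" for n by (simp add: s_def mult_nonneg_nonpos)
        thus ?thesis using True by (simp add: A)
      next
        case False
        then obtain m :: nat where m: "m * (x - a) \<ge> 1"
          using reals_Archimedean3[of "x - a"] by (metis diff_gt_0_iff_gt less_imp_le not_le)
        have "eventually (\<lambda>n. complex_of_real (s n x) = 0) sequentially"
          using eventually_ge_at_top[of m]
        proof eventually_elim
          case (elim n)
          have "real m * (x - a) \<le> real n * (x - a)" using elim False by (intro mult_right_mono) auto
          thus ?case using m by (simp add: s_def)
        qed
        thus ?thesis using False by (auto simp: A intro: tendsto_eventually)
      qed
      show "cmod (complex_of_real (s n x)) \<le> 1" for n x by (simp add: s_def)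
    qed (auto simp: A)
  next
    case empty
    show ?case using exp_closure_zero by (simp add: indicator_def[abs_def])
  next
    case (compl A)
    have "(\<lambda>x. expo 0 x + (- 1) * indicator A x) \<in> exp_closure M \<Lambda>"
      by (intro exp_closure_add exp_closure_scale ex compl)
    also have "(\<lambda>x. expo 0 x + (- 1) * indicator A x) = indicator (UNIV - A)"
      by (auto simp: indicator_def fun_eq_iff)
    finally show ?case .
  next
    case (union A)
    have [measurable]: "A i \<in> sets borel" for i using union(2) by (auto simp: borel_eq_atMost)
    show ?case
    proof (rule exp_closure_dominated[of _ "\<lambda>n x. \<Sum>i<n. indicator (A i) x" _ "\<lambda>_. 1"])
      show "(\<lambda>x. \<Sum>i<n. indicator (A i) x) \<in> exp_closure M \<Lambda>" for n
        using union(3) by (intro exp_closure_sum) auto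
      have eq: "(\<Sum>i<n. indicator (A i) x) = (indicator (\<Union>i<n. A i) x :: complex)" for n x
        using union(1) by (subst indicator_UN_disjoint) (auto simp: disjoint_family_on_def)
      show "(\<lambda>n. \<Sum>i<n. indicator (A i) x) \<longlonglongrightarrow> (indicator (\<Union>i. A i) x :: complex)" for x
        unfolding eq by (rule LIMSEQ_indicator_UN)
      show "cmod (\<Sum>i<n. indicator (A i) x) \<le> 1" for n x
        unfolding eq by (simp add: indicator_def)
    qed auto
  qed
qed

lemma exp_closure_UNIV:
  assumes K: "compact K" "measure M (- K) = 0" and ex: "\<And>l. expo l \<in> exp_closure M \<Lambda>"
    and f: "square_integrable M f"
  shows "f \<in> exp_closure M \<Lambda>"
proof -
  have fm: "f \<in> borel_measurable borel" using f
    by (simp add: square_integrable_def measurable_cong_sets[OF events_eq_borel refl])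
  then obtain s where s: "\<And>i. simple_function borel (s i)" "\<And>x. (\<lambda>i. s i x) \<longlonglongrightarrow> f x"
      "\<And>i x. cmod (s i x) \<le> 2 * cmod (f x)"
    using borel_measurable_implies_sequence_metric[OF fm, of 0] by auto
  show ?thesis
  proof (rule exp_closure_dominated[OF fm _ s(2)])
    show "integrable M (\<lambda>x. (2 * cmod (f x))\<^sup>2)"
      using f by (simp add: square_integrable_def power_mult_distrib)
    show "cmod (s n x) \<le> 2 * cmod (f x)" for n x by (rule s(3))
    show "s n \<in> exp_closure M \<Lambda>" for n
    proof -
      have fin: "finite (range (s n))" using s(1)[of n] by (simp add: simple_function_def)
      have meas: "s n -` {y} \<in> sets borel" for y
        using simple_functionD(2)[OF s(1)[of n], of "{y}"] by simp
      have "(\<lambda>x. \<Sum>y\<in>range (s n). y * indicator (s n -` {y}) x) \<in> exp_closure M \<Lambda>"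
        by (intro exp_closure_sum exp_closure_scale exp_closure_indicator[OF K ex] fin meas)
      also have "(\<lambda>x. \<Sum>y\<in>range (s n). y * indicator (s n -` {y}) x) = s n"
      proof
        fix x
        have "(\<Sum>y\<in>range (s n). y * indicator (s n -` {y}) x) = (\<Sum>y\<in>range (s n). if s n x = y then y else 0)"
          by (intro sum.cong) auto
        also have "\<dots> = s n x" using fin by simp
        finally show "(\<Sum>y\<in>range (s n). y * indicator (s n -` {y}) x) = s n x" .
      qed
      finally show ?thesis .
    qed
  qed
qed

end

section \<open>The self-similar measure and its Fourier transform\<close>

definition fourier :: "real measure \<Rightarrow> real \<Rightarrow> complex" where
  "fourier \<mu> \<xi> = (\<integral>x. expo \<xi> x \<partial>\<mu>)"

lemma expo_divide: "expo l (x / c) = expo (l / c) x"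
  by (simp add: expo_def)

text \<open>Opens access to characteristic functions: continuity, the bound 1 and Levy's uniqueness
  theorem.\<close>

lemma fourier_char: "fourier \<mu> \<xi> = char \<mu> (- 2 * pi * \<xi>)"
  by (simp add: fourier_def char_def expo_def mult_ac)

context real_distribution
begin

lemma integrable_expo: "integrable M (expo l)"
  by (intro integrable_const_bound[of _ 1]) auto

lemma fourier_0: "fourier M 0 = 1"
  by (simp add: fourier_char char_zero)

lemma cmod_fourier_le: "cmod (fourier M \<xi>) \<le> 1"
  by (simp add: fourier_char cmod_char_le_1)

lemma isCont_fourier: "isCont (fourier M) \<xi>"
  unfolding fourier_char by (intro isCont_o2[OF _ isCont_char] continuous_intros)

lemma fourier_minus: "fourier M (- \<xi>) = cnj (fourier M \<xi>)"
  by (simp add: fourier_def flip: cnj_expo integral_cnj)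

end

locale cantor_measure =
  fixes N q :: nat
  assumes N: "N \<ge> 1" and q: "q \<ge> 2"
begin

definition b :: real where "b = real (q * N)"
abbreviation digits :: "real set" where "digits \<equiv> (*) (real q) ` D_set N"

definition \<phi> :: "nat \<Rightarrow> real \<Rightarrow> real" where "\<phi> d x = (x + real q * real d) / b"

text \<open>The Fourier transform of the uniform distribution on the digits, up to a phase a
  normalised Dirichlet kernel.\<close>

definition mask :: "real \<Rightarrow> complex" where
  "mask y = (\<Sum>d<N. expo y (real q * real d)) / of_nat N"

lemma qN_ge_2: "q * N \<ge> 2"
  using N q by (metis mult_le_mono nat_mult_1_right)

lemma b_ge_2: "b \<ge> 2"
  unfolding b_def using qN_ge_2 by (metis of_nat_le_iff of_nat_numeral)

lemma b_pos: "b > 0" using b_ge_2 by linarith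

lemma phi_measurable [measurable]: "\<phi> d \<in> borel_measurable borel"
  unfolding \<phi>_def by measurable

lemma self_similar_iff:
  "self_similar b digits \<mu> \<longleftrightarrow> prob_space \<mu> \<and> sets \<mu> = sets borel \<and>
     (\<forall>A\<in>sets borel. measure \<mu> A = (\<Sum>d<N. measure \<mu> (\<phi> d -` A)) / real N)"
proof -
  have D: "digits = (\<lambda>d. real q * real d) ` {..<N}"
    by (simp add: D_set_def image_image atLeast0LessThan)
  have inj: "inj_on (\<lambda>d. real q * real d) {..<N}" using q by (auto simp: inj_on_def)
  have card: "card digits = N" unfolding D by (simp add: card_image[OF inj])
  have "(\<Sum>a\<in>digits. measure \<mu> (ifs_map b a -` A)) = (\<Sum>d<N. measure \<mu> (\<phi> d -` A))" for A
    unfolding D by (subst sum.reindex[OF inj]) (simp add: \<phi>_def[abs_def] ifs_map_def[abs_def])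
  thus ?thesis by (simp add: self_similar_def card)
qed

text \<open>The measure is the law of \<open>\<phi> d x\<close> with \<open>d\<close> uniform below
  \<open>N\<close> and \<open>x\<close> drawn independently from the measure itself; Fubini then
  separates the two factors.\<close>

lemma fourier_step:
  assumes "self_similar b digits \<mu>"
  shows "fourier \<mu> \<xi> = mask (\<xi> / b) * fourier \<mu> (\<xi> / b)"
proof -
  have ss: "prob_space \<mu>" "sets \<mu> = sets borel"
      "\<And>A. A \<in> sets borel \<Longrightarrow> measure \<mu> A = (\<Sum>d<N. measure \<mu> (\<phi> d -` A)) / real N"
    using assms by (auto simp: self_similar_iff)
  interpret R: real_distribution \<mu>
    using ss(1,2) by (intro real_distribution.intro real_distribution_axioms.intro)
  define U where "U = measure_pmf (pmf_of_set {..<N})"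
  have ne: "{..<N} \<noteq> {}" "finite {..<N}" using N by (auto simp: lessThan_empty_iff)
  interpret U: prob_space U unfolding U_def by (rule measure_pmf.prob_space_axioms)
  interpret P: pair_prob_space U \<mu> ..
  have [measurable_cong]: "sets U = sets (count_space UNIV)" by (simp add: U_def)
  have [measurable]: "(\<lambda>z. \<phi> (fst z) (snd z)) \<in> borel_measurable (U \<Otimes>\<^sub>M \<mu>)"
    unfolding \<phi>_def by measurable
  have eq: "\<mu> = distr (U \<Otimes>\<^sub>M \<mu>) borel (\<lambda>z. \<phi> (fst z) (snd z))"
  proof (rule measure_eqI)
    fix A assume "A \<in> sets \<mu>"
    hence A [measurable]: "A \<in> sets borel" by simp
    have [simp]: "space U = UNIV" by (simp add: U_def)
    have "emeasure (distr (U \<Otimes>\<^sub>M \<mu>) borel (\<lambda>z. \<phi> (fst z) (snd z))) A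
        = emeasure (U \<Otimes>\<^sub>M \<mu>) ((\<lambda>z. \<phi> (fst z) (snd z)) -` A \<inter> space (U \<Otimes>\<^sub>M \<mu>))"
      by (intro emeasure_distr) auto
    also have "\<dots> = (\<integral>\<^sup>+d. emeasure \<mu> (Pair d -` ((\<lambda>z. \<phi> (fst z) (snd z)) -` A \<inter> space (U \<Otimes>\<^sub>M \<mu>))) \<partial>U)"
      by (intro R.emeasure_pair_measure_alt) measurable
    also have "\<dots> = (\<integral>\<^sup>+d. emeasure \<mu> (\<phi> d -` A) \<partial>U)"
      by (intro nn_integral_cong arg_cong2[where f = emeasure]) (auto simp: space_pair_measure)
    also have "\<dots> = (\<Sum>d<N. emeasure \<mu> (\<phi> d -` A)) / of_nat N"
      unfolding U_def by (simp add: nn_integral_pmf_of_set[OF ne])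
    also have "\<dots> = ennreal ((\<Sum>d<N. measure \<mu> (\<phi> d -` A)) / real N)"
      using N by (simp add: R.emeasure_eq_measure sum_ennreal ennreal_of_nat_eq_real_of_nat divide_ennreal sum_nonneg)
    also have "\<dots> = emeasure \<mu> A" using ss(3)[OF A] by (simp add: R.emeasure_eq_measure)
    finally show "emeasure \<mu> A = emeasure (distr (U \<Otimes>\<^sub>M \<mu>) borel (\<lambda>z. \<phi> (fst z) (snd z))) A" ..
  qed simp
  have "fourier \<mu> \<xi> = (\<integral>x. expo \<xi> x \<partial>distr (U \<Otimes>\<^sub>M \<mu>) borel (\<lambda>z. \<phi> (fst z) (snd z)))"
    unfolding fourier_def by (subst eq) simp
  also have "\<dots> = (\<integral>z. expo \<xi> (\<phi> (fst z) (snd z)) \<partial>(U \<Otimes>\<^sub>M \<mu>))"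
    by (intro integral_distr) auto
  also have "\<dots> = (\<integral>d. (\<integral>x. expo \<xi> (\<phi> d x) \<partial>\<mu>) \<partial>U)"
    by (subst P.integral_fst'[symmetric]) (auto intro!: P.P.integrable_const_bound[of _ 1])
  also have "\<dots> = (\<integral>d. expo (\<xi> / b) (real q * real d) * fourier \<mu> (\<xi> / b) \<partial>U)"
  proof (intro Bochner_Integration.integral_cong refl)
    fix d
    have "expo \<xi> (\<phi> d x) = expo (\<xi> / b) (real q * real d) * expo (\<xi> / b) x" for x
      by (simp add: \<phi>_def expo_divide expo_add_right)
    thus "(\<integral>x. expo \<xi> (\<phi> d x) \<partial>\<mu>) = expo (\<xi> / b) (real q * real d) * fourier \<mu> (\<xi> / b)"
      by (simp add: fourier_def)
  qed
  also have "\<dots> = mask (\<xi> / b) * fourier \<mu> (\<xi> / b)"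
    unfolding U_def
    by (subst integral_measure_pmf[of "{..<N}"])
       (use N in \<open>auto simp: set_pmf_of_set[OF ne] pmf_of_set[OF ne] mask_def sum_distrib_right
          sum_divide_distrib scaleR_conv_of_real intro!: sum.cong\<close>)
  finally show ?thesis .
qed

section \<open>Uniqueness and existence of the self-similar measure\<close>

lemma cmod_mask_le: "cmod (mask y) \<le> 1"
proof -
  have "cmod (\<Sum>d<N. expo y (real q * real d)) \<le> (\<Sum>d<N. 1)"
    by (rule sum_norm_le) simp
  thus ?thesis using N by (simp add: mask_def norm_divide field_simps)
qed

lemma fourier_iterate:
  assumes "self_similar b digits \<mu>"
  shows "fourier \<mu> \<xi> = (\<Prod>j<n. mask (\<xi> / b ^ Suc j)) * fourier \<mu> (\<xi> / b ^ n)"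
proof (induction n)
  case (Suc n)
  show ?case using fourier_step[OF assms, of "\<xi> / b ^ n"] Suc.IH by (simp add: field_simps)
qed simp

lemma div_power_tendsto_0: "(\<lambda>n. \<xi> / b ^ n) \<longlonglongrightarrow> 0"
proof -
  have "(\<lambda>n. \<xi> * (1 / b) ^ n) \<longlonglongrightarrow> \<xi> * 0"
    using b_ge_2 by (intro tendsto_intros LIMSEQ_realpow_zero) auto
  thus ?thesis by (simp add: power_divide)
qed

text \<open>The \<open>mask\<close> factors have modulus at most 1, so the two transforms differ at
  \<open>\<xi>\<close> by no more than at \<open>\<xi> / b ^ n\<close>, where both tend to
  1.\<close>

lemma self_similar_unique:
  assumes "self_similar b digits \<mu>" "self_similar b digits \<nu>"
  shows "\<mu> = \<nu>"
proof -
  interpret A: real_distribution \<mu>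
    using assms by (intro real_distribution.intro real_distribution_axioms.intro) (auto simp: self_similar_def)
  interpret B: real_distribution \<nu>
    using assms by (intro real_distribution.intro real_distribution_axioms.intro) (auto simp: self_similar_def)
  have "fourier \<mu> \<xi> = fourier \<nu> \<xi>" for \<xi>
  proof -
    have "(\<lambda>n. fourier \<mu> (\<xi> / b ^ n)) \<longlonglongrightarrow> 1" "(\<lambda>n. fourier \<nu> (\<xi> / b ^ n)) \<longlonglongrightarrow> 1"
      using isCont_tendsto_compose[OF A.isCont_fourier div_power_tendsto_0]
        isCont_tendsto_compose[OF B.isCont_fourier div_power_tendsto_0]
      by (simp_all add: A.fourier_0 B.fourier_0)
    hence "(\<lambda>n. cmod (fourier \<mu> (\<xi> / b ^ n) - fourier \<nu> (\<xi> / b ^ n))) \<longlonglongrightarrow> cmod (1 - 1)"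
      by (intro tendsto_intros)
    moreover have "cmod (fourier \<mu> \<xi> - fourier \<nu> \<xi>) \<le> cmod (fourier \<mu> (\<xi> / b ^ n) - fourier \<nu> (\<xi> / b ^ n))" for n
    proof -
      have "fourier \<mu> \<xi> - fourier \<nu> \<xi> = (\<Prod>j<n. mask (\<xi> / b ^ Suc j)) * (fourier \<mu> (\<xi> / b ^ n) - fourier \<nu> (\<xi> / b ^ n))"
        using fourier_iterate[OF assms(1), of \<xi> n] fourier_iterate[OF assms(2), of \<xi> n]
        by (simp add: right_diff_distrib)
      moreover have "cmod (\<Prod>j<n. mask (\<xi> / b ^ Suc j)) \<le> 1"
        unfolding prod_norm[symmetric] by (intro prod_le_1) (auto intro: cmod_mask_le)
      ultimately show ?thesis by (simp only: norm_mult mult_left_le_one_le norm_ge_zero)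
    qed
    ultimately have "cmod (fourier \<mu> \<xi> - fourier \<nu> \<xi>) \<le> cmod (1 - 1)"
      by (intro LIMSEQ_le_const) auto
    thus ?thesis by simp
  qed
  hence "char \<mu> t = char \<nu> t" for t
    using fourier_char[of \<mu> "- t / (2 * pi)"] fourier_char[of \<nu> "- t / (2 * pi)"] by simp
  thus ?thesis by (intro Levy_uniqueness A.real_distribution_axioms B.real_distribution_axioms) auto
qed

text \<open>Reduction modulo \<open>N\<close> makes the series converge for every stream, not just almost surely.\<close>

definition digit_series :: "nat stream \<Rightarrow> real" where
  "digit_series s = (\<Sum>k. real q * real (s !! k mod N) / b ^ Suc k)"

lemma digit_series_bound:
  "norm (real q * real (s !! k mod N) / b ^ Suc k) \<le> (1 / b) ^ k"
proof -
  have "real (s !! k mod N) \<le> real N" using N by (intro of_nat_mono less_imp_le mod_less_divisor) auto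
  hence "real q * real (s !! k mod N) \<le> b" by (simp add: b_def mult_left_mono)
  thus ?thesis using b_pos by (simp add: field_simps)
qed

lemma summable_digit_series: "summable (\<lambda>k. real q * real (s !! k mod N) / b ^ Suc k)"
proof (rule summable_comparison_test)
  show "summable (\<lambda>k. (1 / b) ^ k)" using b_ge_2 by (intro summable_geometric) simp
qed (blast intro: digit_series_bound)

lemma digit_series_range: "digit_series s \<in> {0..2}"
proof -
  have "digit_series s \<le> (\<Sum>k. (1 / b) ^ k)"
    unfolding digit_series_def using b_ge_2 digit_series_bound
    by (intro suminf_le summable_digit_series summable_geometric) (auto dest: order_trans[OF abs_ge_self] simp: abs_le_iff)
  also have "\<dots> = 1 / (1 - 1 / b)" using b_ge_2 by (intro suminf_geometric) auto
  also have "\<dots> \<le> 2" using b_ge_2 by (simp add: field_simps)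
  finally have "digit_series s \<le> 2" .
  moreover have "digit_series s \<ge> 0"
    unfolding digit_series_def using b_pos by (intro suminf_nonneg summable_digit_series) auto
  ultimately show ?thesis by simp
qed

lemma digit_series_Stream:
  assumes "d < N"
  shows "digit_series (d ## s) = \<phi> d (digit_series s)"
proof -
  let ?f = "\<lambda>k. real q * real ((d ## s) !! k mod N) / b ^ Suc k"
  have "(\<Sum>k. ?f k) = (\<Sum>k. ?f (Suc k)) + ?f 0"
    using suminf_split_head[OF summable_digit_series[of "d ## s"]] by simp
  also have "(\<Sum>k. ?f (Suc k)) = (\<Sum>k. (real q * real (s !! k mod N) / b ^ Suc k) / b)"
    by (simp add: mult_ac)
  also have "\<dots> = digit_series s / b"
    unfolding digit_series_def by (rule suminf_divide[OF summable_digit_series])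
  finally show ?thesis using assms unfolding \<phi>_def digit_series_def by (simp add: add_divide_distrib)
qed

text \<open>The law of \<open>digit_series\<close> under independent uniform digits; splitting off
  the first digit of the stream is the self-similarity relation.\<close>

lemma self_similar_exists: "\<exists>\<mu>. self_similar b digits \<mu> \<and> measure \<mu> (- {0..2}) = 0"
proof -
  define U where "U = measure_pmf (pmf_of_set {..<N})"
  have ne: "{..<N} \<noteq> {}" "finite {..<N}" using N by (auto simp: lessThan_empty_iff)
  interpret U: prob_space U unfolding U_def by (rule measure_pmf.prob_space_axioms)
  interpret S: prob_space "stream_space U" by (rule U.prob_space_stream_space)
  have [measurable_cong]: "sets U = sets (count_space UNIV)" by (simp add: U_def)
  have [measurable]: "digit_series \<in> borel_measurable (stream_space U)"
    unfolding digit_series_def[abs_def] by measurable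
  define \<mu> where "\<mu> = distr (stream_space U) borel digit_series"
  interpret \<mu>: prob_space \<mu> unfolding \<mu>_def by (rule S.prob_space_distr) simp
  have space: "space (stream_space U) = UNIV" by (simp add: space_stream_space U_def)
  have em: "emeasure \<mu> A = emeasure (stream_space U) (digit_series -` A)" if "A \<in> sets borel" for A
    using that by (simp add: \<mu>_def emeasure_distr space)
  have ss: "measure \<mu> A = (\<Sum>d<N. measure \<mu> (\<phi> d -` A)) / real N" if A [measurable]: "A \<in> sets borel" for A
  proof -
    have meas [measurable]: "\<phi> d -` A \<in> sets borel" for d
      using measurable_sets[OF phi_measurable A] by simp
    have "emeasure \<mu> A = emeasure (stream_space U) (digit_series -` A)" by (rule em) fact
    also have "\<dots> = (\<integral>\<^sup>+d. emeasure (stream_space U) {s\<in>space (stream_space U). d ## s \<in> digit_series -` A} \<partial>U)"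
      using measurable_sets[of digit_series "stream_space U" borel A] space
      by (intro U.emeasure_stream_space) simp
    also have "\<dots> = (\<Sum>d<N. emeasure (stream_space U) {s. d ## s \<in> digit_series -` A}) / of_nat N"
      unfolding U_def[symmetric] space
      by (simp add: U_def nn_integral_pmf_of_set[OF ne])
    also have "(\<Sum>d<N. emeasure (stream_space U) {s. d ## s \<in> digit_series -` A})
        = (\<Sum>d<N. emeasure \<mu> (\<phi> d -` A))"
    proof (intro sum.cong refl)
      fix d assume "d \<in> {..<N}"
      hence "{s. d ## s \<in> digit_series -` A} = digit_series -` (\<phi> d -` A)"
        by (auto simp: digit_series_Stream)
      thus "emeasure (stream_space U) {s. d ## s \<in> digit_series -` A} = emeasure \<mu> (\<phi> d -` A)"
        by (simp add: em[OF meas])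
    qed
    also have "\<dots> / of_nat N = ennreal ((\<Sum>d<N. measure \<mu> (\<phi> d -` A)) / real N)"
      using N by (simp add: \<mu>.emeasure_eq_measure sum_ennreal ennreal_of_nat_eq_real_of_nat divide_ennreal sum_nonneg)
    finally have "ennreal (measure \<mu> A) = ennreal ((\<Sum>d<N. measure \<mu> (\<phi> d -` A)) / real N)"
      by (simp add: \<mu>.emeasure_eq_measure)
    thus ?thesis by (subst (asm) ennreal_inj) (auto intro!: divide_nonneg_nonneg sum_nonneg)
  qed
  have "emeasure \<mu> (- {0..2}) = emeasure (stream_space U) (digit_series -` (- {0..2}))" by (rule em) auto
  also have "digit_series -` (- {0..2}) = {}" using digit_series_range by blast
  finally have "measure \<mu> (- {0..2}) = 0" by (simp add: measure_def)
  moreover have "self_similar b digits \<mu>"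
    unfolding self_similar_iff using ss \<mu>.prob_space_axioms by (auto simp: \<mu>_def)
  ultimately show ?thesis by blast
qed

definition \<mu> :: "real measure" where "\<mu> = ss_measure b digits"

lemma self_similar_mu: "self_similar b digits \<mu>" and mu_compact: "measure \<mu> (- {0..2}) = 0"
proof -
  obtain \<nu> where \<nu>: "self_similar b digits \<nu>" "measure \<nu> (- {0..2}) = 0"
    using self_similar_exists by blast
  have "\<mu> = \<nu>" unfolding \<mu>_def ss_measure_def
    using \<nu>(1) self_similar_unique by (intro the_equality) auto
  with \<nu> show "self_similar b digits \<mu>" "measure \<mu> (- {0..2}) = 0" by auto
qed

sublocale mu: real_distribution \<mu>
  using self_similar_mu by (intro real_distribution.intro real_distribution_axioms.intro) (auto simp: self_similar_def)

end

section \<open>Zeros of the Fourier transform; the frequency set\<close>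

lemma expo_eq_1_iff: "expo l x = 1 \<longleftrightarrow> l * x \<in> \<int>"
proof -
  have "expo l x = 1 \<longleftrightarrow> (\<exists>n::int. - (2 * pi * (l * x)) = of_int (2 * n) * pi)"
    by (simp add: expo_def exp_eq_1 mult_ac)
  also have "\<dots> \<longleftrightarrow> (\<exists>n::int. l * x = of_int n)"
  proof
    assume "\<exists>n::int. - (2 * pi * (l * x)) = of_int (2 * n) * pi"
    then obtain n :: int where "- (2 * pi * (l * x)) = of_int (2 * n) * pi" by blast
    hence "pi * (l * x) = pi * of_int (- n)" by (simp add: algebra_simps)
    hence "l * x = of_int (- n)" by (subst (asm) mult_cancel_left) simp
    thus "\<exists>n::int. l * x = of_int n" by blast
  next
    assume "\<exists>n::int. l * x = of_int n"
    then obtain n :: int where "l * x = of_int n" by blast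
    thus "\<exists>n::int. - (2 * pi * (l * x)) = of_int (2 * n) * pi"
      by (intro exI[of _ "- n"]) (simp add: algebra_simps)
  qed
  finally show ?thesis by (auto elim: Ints_cases)
qed

lemma expo_of_nat_mult: "expo l (real n * x) = expo l x ^ n"
  by (simp add: expo_def mult_ac flip: exp_of_nat_mult)

lemma expo_sum_eq:
  fixes l x :: real
  assumes "N \<ge> 1" "real N * (l * x) \<in> \<int>"
  shows "(\<Sum>d<N. expo l (x * real d)) = (if l * x \<in> \<int> then of_nat N else 0)"
proof (cases "l * x \<in> \<int>")
  case True
  hence "expo l (x * real d) = 1" for d
    by (simp add: expo_eq_1_iff mult.assoc[symmetric] Ints_mult)
  thus ?thesis using True by simp
next
  case False
  hence "expo l x \<noteq> 1" by (simp add: expo_eq_1_iff)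
  moreover have "expo l x ^ N = 1"
    using assms(2) by (simp flip: expo_of_nat_mult add: expo_eq_1_iff mult_ac)
  ultimately have "(\<Sum>d<N. expo l x ^ d) = 0" by (simp add: sum_gp_strict)
  thus ?thesis using False by (simp add: mult.commute[of x] expo_of_nat_mult)
qed

context cantor_measure
begin

lemma b_Ints: "b \<in> \<int>" unfolding b_def by (rule Ints_of_nat)

text \<open>A geometric sum: it vanishes exactly when \<open>expo y q\<close> is an
  \<open>N\<close>-th root of unity other than 1, and \<open>q * N = b\<close>.\<close>

lemma mask_eq_0_iff: "mask y = 0 \<longleftrightarrow> b * y \<in> \<int> \<and> real q * y \<notin> \<int>"
proof
  assume 0: "mask y = 0"
  have q: "real q * y \<notin> \<int>"
  proof
    assume "real q * y \<in> \<int>"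
    moreover from this have "real N * (real q * y) \<in> \<int>" by (rule Ints_mult[OF Ints_of_nat])
    ultimately have "mask y = 1" using N expo_sum_eq[of N y "real q"] by (simp add: mask_def mult_ac)
    thus False using 0 by simp
  qed
  hence ne: "expo y (real q) \<noteq> 1" by (simp add: expo_eq_1_iff mult_ac)
  have "(\<Sum>d<N. expo y (real q) ^ d) = 0"
    using 0 N by (simp add: mask_def mult.commute[of "real q"] expo_of_nat_mult)
  hence "expo y (real q) ^ N = 1" using ne by (simp add: sum_gp_strict)
  hence "b * y \<in> \<int>" by (simp flip: expo_of_nat_mult add: expo_eq_1_iff b_def mult_ac)
  with q show "b * y \<in> \<int> \<and> real q * y \<notin> \<int>" by simp
next
  assume "b * y \<in> \<int> \<and> real q * y \<notin> \<int>"
  thus "mask y = 0" using N expo_sum_eq[of N y "real q"]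
    by (simp add: mask_def b_def mult_ac)
qed

lemma mask_add_int:
  assumes "k \<in> \<int>"
  shows "mask (y + k) = mask y"
proof -
  have "expo k (real q * real d) = 1" for d
    using assms by (simp add: expo_eq_1_iff Ints_mult)
  thus ?thesis by (simp add: mask_def expo_add_left)
qed

text \<open>For large \<open>n\<close> the factor at \<open>\<xi> / b ^ n\<close> is close to
  \<open>fourier \<mu> 0 = 1\<close>, so one of the finitely many \<open>mask\<close> factors must
  vanish.\<close>

lemma fourier_eq_0_imp:
  assumes "fourier \<mu> \<xi> = 0"
  shows "\<xi> \<in> \<int>"
proof -
  have "(\<lambda>n. fourier \<mu> (\<xi> / b ^ n)) \<longlonglongrightarrow> fourier \<mu> 0"
    by (rule isCont_tendsto_compose[OF mu.isCont_fourier div_power_tendsto_0])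
  hence "eventually (\<lambda>n. fourier \<mu> (\<xi> / b ^ n) \<noteq> 0) sequentially"
    by (rule tendsto_imp_eventually_ne) (simp add: mu.fourier_0)
  then obtain n where "fourier \<mu> (\<xi> / b ^ n) \<noteq> 0"
    by (meson eventually_happens trivial_limit_sequentially)
  hence "(\<Prod>j<n. mask (\<xi> / b ^ Suc j)) = 0"
    using assms fourier_iterate[OF self_similar_mu, of \<xi> n] by simp
  then obtain j where "mask (\<xi> / b ^ Suc j) = 0" by (auto simp: prod_zero_iff)
  hence "b * (\<xi> / b ^ Suc j) \<in> \<int>" unfolding mask_eq_0_iff by (rule conjunct1)
  hence "b ^ j * (b * (\<xi> / b ^ Suc j)) \<in> \<int>" by (rule Ints_mult[OF Ints_power[OF b_Ints]])
  also have "b ^ j * (b * (\<xi> / b ^ Suc j)) = \<xi>" using b_pos by simp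
  finally show ?thesis .
qed

text \<open>The factor with index \<open>j\<close> is \<open>mask (r / b)\<close>, and
  \<open>q * r / b = r / N\<close> is not an integer.\<close>

lemma fourier_eq_0:
  fixes r :: int
  assumes "\<not> int N dvd r"
  shows "fourier \<mu> (b ^ j * of_int r) = 0"
proof -
  have "real q * (real_of_int r / b) \<notin> \<int>"
  proof
    assume "real q * (real_of_int r / b) \<in> \<int>"
    then obtain z :: int where "real q * (real_of_int r / b) = of_int z" by (auto elim: Ints_cases)
    hence "real_of_int r = of_int (z * int N)" using N q by (simp add: b_def field_simps)
    hence "r = z * int N" by (simp only: of_int_eq_iff)
    thus False using assms by simp
  qed
  hence "mask (real_of_int r / b) = 0" using b_pos by (simp add: mask_eq_0_iff)
  moreover have "b ^ j * real_of_int r / b ^ Suc j = real_of_int r / b" using b_pos by simp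
  ultimately have "(\<Prod>i<Suc j. mask (b ^ j * real_of_int r / b ^ Suc i)) = 0"
    by (intro prod_zero bexI[of _ j]) (simp_all only: finite_lessThan lessThan_iff lessI)
  thus ?thesis using fourier_iterate[OF self_similar_mu, of "b ^ j * of_int r" "Suc j"] by simp
qed

section \<open>Digits and finite expansions in base \<open>b\<close>\<close>

definition Cint :: "int set" where "Cint = {c. - int N < 2 * c \<and> 2 * c \<le> int N}"

lemma C_set_eq: "C_set N = real_of_int ` Cint"
proof -
  have "- (real N / 2) < real_of_int c \<and> real_of_int c \<le> real N / 2 \<longleftrightarrow> c \<in> Cint" for c
  proof -
    have "- (real N / 2) < real_of_int c \<longleftrightarrow> real_of_int (- int N) < real_of_int (2 * c)"
      by simp linarith
    moreover have "real_of_int c \<le> real N / 2 \<longleftrightarrow> real_of_int (2 * c) \<le> real_of_int (int N)"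
      by simp linarith
    ultimately show ?thesis unfolding Cint_def of_int_less_iff of_int_le_iff by simp
  qed
  thus ?thesis unfolding C_set_def by (auto elim!: Ints_cases)
qed

text \<open>For either parity of \<open>N\<close> the least digit is
  \<open>- ((N - 1) div 2)\<close>. In this form sums of exponentials over the digits become
  geometric sums.\<close>

lemma Cint_image: "Cint = (\<lambda>i. int i - (int N - 1) div 2) ` {..<N}"
proof -
  have "c \<in> (\<lambda>i. int i - (int N - 1) div 2) ` {..<N}" if "c \<in> Cint" for c
    using that unfolding Cint_def by (intro image_eqI[of _ _ "nat (c + (int N - 1) div 2)"]) auto
  thus ?thesis unfolding Cint_def by auto
qed

lemma finite_Cint: "finite Cint" unfolding Cint_image by simp

lemma card_Cint: "card Cint = N" unfolding Cint_image by (subst card_image) (auto simp: inj_on_def)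

lemma zero_in_Cint: "0 \<in> Cint" using N by (simp add: Cint_def)

lemma one_in_Cint: "N \<noteq> 1 \<Longrightarrow> 1 \<in> Cint" using N by (simp add: Cint_def)

lemma Cint_cong_imp_eq:
  assumes "c \<in> Cint" "c' \<in> Cint" "int N dvd c - c'"
  shows "c = c'"
proof -
  have "\<bar>c - c'\<bar> < int N" using assms(1,2) by (auto simp: Cint_def)
  thus ?thesis using assms(3) zdvd_not_zless[of "\<bar>c - c'\<bar>" "int N"] by auto
qed

definition bi :: int where "bi = int (q * N)"

lemma b_eq: "b = real_of_int bi" by (simp add: bi_def b_def)

lemma N_dvd_bi: "int N dvd bi" by (simp add: bi_def)

lemma bi_pos: "bi > 0" using qN_ge_2 unfolding bi_def by linarith

text \<open>Each step adds a lowest digit, which is the one that a single division by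
  \<open>b\<close> in \<open>fourier_step\<close> brings out. Leading zeros are allowed, so the sets
  increase with \<open>n\<close>.\<close>

fun frequencies :: "nat \<Rightarrow> int set" where
  "frequencies 0 = {0}"
| "frequencies (Suc n) = (\<lambda>(c, l). c + bi * l) ` (Cint \<times> frequencies n)"

declare frequencies.simps(2) [simp del]

lemma finite_frequencies: "finite (frequencies n)"
  by (induction n) (auto simp: finite_Cint frequencies.simps(2))

lemma inj_on_frequencies: "inj_on (\<lambda>(c, l). c + bi * l) (Cint \<times> L)"
proof (intro inj_onI; clarify)
  fix c l c' l' assume *: "c \<in> Cint" "c' \<in> Cint" "c + bi * l = c' + bi * l'"
  have "c - c' = bi * (l' - l)" using *(3) by (simp add: algebra_simps)
  hence "int N dvd c - c'" using N_dvd_bi by (metis dvd_mult2)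
  hence "c = c'" using * Cint_cong_imp_eq by blast
  thus "c = c' \<and> l = l'" using * bi_pos by simp
qed

lemma card_frequencies: "card (frequencies n) = N ^ n"
  by (induction n) (simp_all add: frequencies.simps(2) card_image[OF inj_on_frequencies] card_cartesian_product card_Cint)

lemma frequencies_mono: "frequencies n \<subseteq> frequencies (Suc n)"
proof (induction n)
  case 0
  show ?case using zero_in_Cint by (force simp: frequencies.simps(2))
next
  case (Suc n)
  thus ?case unfolding frequencies.simps(2)[of "Suc n"] by (subst frequencies.simps(2)) (intro image_mono Sigma_mono order_refl)
qed

lemma frequencies_le: "m \<le> n \<Longrightarrow> frequencies m \<subseteq> frequencies n"
  by (rule lift_Suc_mono_le[of frequencies]) (rule frequencies_mono)

lemma frequencies_Suc_eq:
  "frequencies (Suc n) = {\<Sum>k=0..n. bi ^ k * c k | c. \<forall>k. c k \<in> Cint}"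
proof (induction n)
  case 0
  have "frequencies (Suc 0) = Cint" by (force simp: frequencies.simps(2))
  thus ?case by (auto intro: exI[of _ "\<lambda>_. _"])
next
  case (Suc n)
  have shift: "(\<Sum>k=0..Suc n. bi ^ k * c k) = c 0 + bi * (\<Sum>k=0..n. bi ^ k * c (Suc k))" for c :: "nat \<Rightarrow> int"
    by (subst sum.atLeast0_atMost_Suc_shift) (simp add: sum_distrib_left mult.assoc)
  show ?case (is "?L = ?R")
  proof (intro equalityI subsetI)
    fix x assume "x \<in> ?L"
    then obtain c0 l where x: "x = c0 + bi * l" "c0 \<in> Cint" "l \<in> frequencies (Suc n)"
      by (auto simp: frequencies.simps(2)[of "Suc n"])
    then obtain c where c: "l = (\<Sum>k=0..n. bi ^ k * c k)" "\<forall>k. c k \<in> Cint" unfolding Suc.IH by auto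
    have "x = (\<Sum>k=0..Suc n. bi ^ k * (case k of 0 \<Rightarrow> c0 | Suc j \<Rightarrow> c j))"
      unfolding shift by (simp add: x c)
    moreover have "\<forall>k. (case k of 0 \<Rightarrow> c0 | Suc j \<Rightarrow> c j) \<in> Cint" using c x by (auto split: nat.split)
    ultimately show "x \<in> ?R" by (intro CollectI exI[of _ "\<lambda>k. case k of 0 \<Rightarrow> c0 | Suc j \<Rightarrow> c j"]) simp
  next
    fix x assume "x \<in> ?R"
    then obtain c where c: "x = (\<Sum>k=0..Suc n. bi ^ k * c k)" "\<forall>k. c k \<in> Cint" by auto
    have "(\<Sum>k=0..n. bi ^ k * c (Suc k)) \<in> frequencies (Suc n)" unfolding Suc.IH using c(2)
      by (intro CollectI exI[of _ "\<lambda>k. c (Suc k)"]) auto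
    thus "x \<in> ?L" unfolding c(1) shift using c(2)
      by (subst frequencies.simps(2)) (intro image_eqI[of _ _ "(c 0, \<Sum>k=0..n. bi ^ k * c (Suc k))"]; auto)
  qed
qed

lemma digit_sums_eq: "digit_sums b (C_set N) = real_of_int ` (\<Union>n. frequencies n)"
proof -
  have "(\<Union>n. frequencies n) = (\<Union>n. frequencies (Suc n))" using frequencies_mono by blast
  also have "\<dots> = {\<Sum>k=0..n. bi ^ k * c k | n c. \<forall>k. c k \<in> Cint}"
    unfolding frequencies_Suc_eq by blast
  finally have eq: "(\<Union>n. frequencies n) = {\<Sum>k=0..n. bi ^ k * c k | n c. \<forall>k. c k \<in> Cint}" .
  have "x \<in> digit_sums b (C_set N) \<longleftrightarrow> x \<in> real_of_int ` (\<Union>n. frequencies n)" for x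
  proof
    assume "x \<in> digit_sums b (C_set N)"
    then obtain n c where c: "x = (\<Sum>k=0..n. b ^ k * c k)" "\<forall>k. c k \<in> C_set N"
      by (auto simp: digit_sums_def)
    then obtain c' where c': "\<And>k. c k = real_of_int (c' k)" "\<And>k. c' k \<in> Cint"
      unfolding C_set_eq image_iff by metis
    have "x = real_of_int (\<Sum>k=0..n. bi ^ k * c' k)" by (simp add: c c' b_eq)
    thus "x \<in> real_of_int ` (\<Union>n. frequencies n)" unfolding eq using c'(2) by blast
  next
    assume "x \<in> real_of_int ` (\<Union>n. frequencies n)"
    then obtain n c where c: "x = real_of_int (\<Sum>k=0..n. bi ^ k * c k)" "\<forall>k. c k \<in> Cint"
      unfolding eq by blast
    have "x = (\<Sum>k=0..n. b ^ k * real_of_int (c k))" by (simp add: c b_eq)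
    moreover have "\<forall>k. real_of_int (c k) \<in> C_set N" using c(2) by (simp add: C_set_eq)
    ultimately show "x \<in> digit_sums b (C_set N)" unfolding digit_sums_def
      by (intro CollectI exI[of _ n] exI[of _ "\<lambda>k. real_of_int (c k)"]) simp
  qed
  thus ?thesis by blast
qed

definition \<Lambda> :: "real \<Rightarrow> real set" where
  "\<Lambda> t = (*) t ` real_of_int ` (\<Union>n. frequencies n)"

definition \<Gamma> :: "real set" where "\<Gamma> = {t. t > 0 \<and> spectral_pair \<mu> (\<Lambda> t)}"

lemma positive_complete_numbers_eq: "positive_complete_numbers N q = \<Gamma>"
  unfolding positive_complete_numbers_def complete_number_def \<Gamma>_def \<Lambda>_def \<mu>_def
    digit_sums_eq[symmetric] b_def[symmetric] ..

end

section \<open>Incomplete numbers\<close>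

lemma (in real_distribution) expo_diff_mult_cnj:
  fixes F :: "real set"
  shows "integrable M (\<lambda>x. (expo s x - (\<Sum>l\<in>F. u l * expo l x)) * cnj (expo m x))" (is ?I)
    and "(\<integral>x. (expo s x - (\<Sum>l\<in>F. u l * expo l x)) * cnj (expo m x) \<partial>M)
      = fourier M (s - m) - (\<Sum>l\<in>F. u l * fourier M (l - m))" (is ?E)
proof -
  have e: "(expo s x - (\<Sum>l\<in>F. u l * expo l x)) * cnj (expo m x)
      = expo (s - m) x - (\<Sum>l\<in>F. u l * expo (l - m) x)" for x
    by (simp add: left_diff_distrib sum_distrib_right cnj_expo mult.assoc flip: expo_add_left)
  show ?I
    unfolding e by (intro Bochner_Integration.integrable_diff Bochner_Integration.integrable_sum
      Bochner_Integration.integrable_mult_right integrable_expo)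
  show ?E
    unfolding e fourier_def
    by (subst Bochner_Integration.integral_diff)
       (auto intro!: Bochner_Integration.integrable_sum integrable_expo simp: integrable_expo)
qed

text \<open>The residual \<open>h\<close> of any approximation has inner product 1 with
  \<open>expo s\<close>. The pointwise bound
  \<open>2 * Re (h x * cnj (expo s x)) - 1 \<le> (cmod (h x))\<^sup>2\<close>, in place of
  Cauchy-Schwarz, keeps its squared norm at least 1.\<close>

lemma (in real_distribution) orthogonal_imp_not_total:
  assumes orth: "\<And>l. l \<in> L \<Longrightarrow> fourier M (s - l) = 0"
  shows "\<not> total_exponentials M L"
proof
  assume "total_exponentials M L"
  then obtain F u where F: "finite F" "F \<subseteq> L"
      "(\<integral>x. (cmod (expo s x - (\<Sum>l\<in>F. u l * expo l x)))\<^sup>2 \<partial>M) < 1"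
    using square_integrable_expo[of s] unfolding total_exponentials_def by (meson zero_less_one)
  define h where "h x = expo s x - (\<Sum>l\<in>F. u l * expo l x)" for x
  have hm [measurable]: "h \<in> borel_measurable borel" unfolding h_def[abs_def] by measurable
  have "square_integrable M h" unfolding h_def[abs_def]
    by (intro square_integrable_diff square_integrable_expo square_integrable_exp_sum F)
  hence hi: "integrable M (\<lambda>x. (cmod (h x))\<^sup>2)" by (simp add: square_integrable_def)
  have i: "integrable M (\<lambda>x. h x * cnj (expo s x))"
    unfolding h_def by (rule expo_diff_mult_cnj)
  have "(\<integral>x. h x * cnj (expo s x) \<partial>M) = 1 - (\<Sum>l\<in>F. u l * fourier M (l - s))"
    unfolding h_def expo_diff_mult_cnj by (simp add: fourier_0)
  also have "(\<Sum>l\<in>F. u l * fourier M (l - s)) = 0"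
  proof (rule sum.neutral, rule ballI)
    fix l assume "l \<in> F"
    hence "fourier M (- (s - l)) = 0" using F orth by (subst fourier_minus) auto
    thus "u l * fourier M (l - s) = 0" by simp
  qed
  finally have 1: "(\<integral>x. h x * cnj (expo s x) \<partial>M) = 1" by simp
  have Re: "integrable M (\<lambda>x. 2 * Re (k x) - 1)" "(\<integral>x. 2 * Re (k x) - 1 \<partial>M) = 2 * Re (\<integral>x. k x \<partial>M) - 1"
    if "integrable M k" for k :: "real \<Rightarrow> complex"
    using that by (simp_all add: prob_space[unfolded space_eq_univ])
  have "1 = (\<integral>x. 2 * Re (h x * cnj (expo s x)) - 1 \<partial>M)"
    unfolding Re(2)[OF i] 1 by simp
  also have "\<dots> \<le> (\<integral>x. (cmod (h x))\<^sup>2 \<partial>M)"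
  proof (rule integral_mono)
    show "integrable M (\<lambda>x. 2 * Re (h x * cnj (expo s x)) - 1)" by (rule Re(1)[OF i])
    fix x
    have "\<bar>Re (h x * cnj (expo s x))\<bar> \<le> cmod (h x)"
      using abs_Re_le_cmod[of "h x * cnj (expo s x)"] by (simp add: norm_mult)
    moreover have "2 * cmod (h x) - 1 \<le> (cmod (h x))\<^sup>2"
      using zero_le_power2[of "cmod (h x) - 1"] by (simp add: power2_eq_square algebra_simps)
    ultimately show "2 * Re (h x * cnj (expo s x)) - 1 \<le> (cmod (h x))\<^sup>2" by linarith
  qed (rule hi)
  finally show False using F(3) unfolding h_def by simp
qed

context cantor_measure
begin

text \<open>Each trailing digit 1 of \<open>l\<close> releases one factor \<open>bi\<close> and
  reproduces the same expression for the remaining digits. The first digit \<open>c\<close> other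
  than 1 leaves the residue \<open>1 - c\<close>, nonzero modulo \<open>N\<close>; if there is none,
  the value 1 is left.\<close>

lemma frequencies_expansion:
  assumes "N \<noteq> 1" "l \<in> frequencies n"
  shows "\<exists>j r. 1 + (bi - 1) * l = bi ^ j * r \<and> \<not> int N dvd r"
  using assms(2)
proof (induction n arbitrary: l)
  case 0
  thus ?case using assms(1) by (intro exI[of _ 0] exI[of _ 1]) auto
next
  case (Suc n)
  then obtain c m where l: "l = c + bi * m" "c \<in> Cint" "m \<in> frequencies n"
    by (auto simp: frequencies.simps(2))
  have eq: "1 + (bi - 1) * l = (1 - c) + bi * (c + (bi - 1) * m)" by (simp add: l algebra_simps)
  show ?case
  proof (cases "c = 1")
    case True
    obtain j r where "1 + (bi - 1) * m = bi ^ j * r" "\<not> int N dvd r" using Suc.IH[OF l(3)] by blast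
    thus ?thesis unfolding eq True by (intro exI[of _ "Suc j"] exI[of _ r]) auto
  next
    case False
    have "\<not> int N dvd 1 - c" using Cint_cong_imp_eq[OF one_in_Cint l(2)] assms(1) False by auto
    hence "\<not> int N dvd 1 + (bi - 1) * l"
      unfolding eq using N_dvd_bi by (metis dvd_add_left_iff dvd_mult2)
    thus ?thesis by (intro exI[of _ 0] exI[of _ "1 + (bi - 1) * l"]) auto
  qed
qed

lemma complete_number_nat:
  assumes "N \<noteq> 1" "t \<in> \<Gamma>"
  obtains k :: nat where "k > 0" "t = real k"
proof -
  have t: "t > 0" "orthonormal_exponentials \<mu> (\<Lambda> t)"
    using assms by (auto simp: \<Gamma>_def spectral_pair_def)
  have "1 \<in> frequencies 1" using one_in_Cint[OF assms(1)] by (force simp: frequencies.simps(2))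
  hence "t * real_of_int 1 \<in> \<Lambda> t" unfolding \<Lambda>_def by blast
  moreover have "0 \<in> frequencies 0" by simp
  hence "t * real_of_int 0 \<in> \<Lambda> t" unfolding \<Lambda>_def by blast
  ultimately have "(\<integral>x. expo t x * cnj (expo 0 x) \<partial>\<mu>) = 0"
    using t unfolding orthonormal_exponentials_def by force
  hence "fourier \<mu> t = 0" by (simp add: fourier_def)
  then obtain z :: int where "t = of_int z" by (auto elim: Ints_cases dest: fourier_eq_0_imp)
  thus ?thesis using t(1) by (intro that[of "nat z"]) auto
qed

lemma complete_number_total:
  fixes s :: real
  assumes "t \<in> \<Gamma>" "\<And>l n. l \<in> frequencies n \<Longrightarrow> fourier \<mu> (s - t * real_of_int l) = 0"
  shows False
proof -
  have "total_exponentials \<mu> (\<Lambda> t)" using assms(1) by (auto simp: \<Gamma>_def spectral_pair_def)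
  moreover have "fourier \<mu> (s - l) = 0" if "l \<in> \<Lambda> t" for l
    using that assms(2) by (auto simp: \<Lambda>_def)
  ultimately show False using mu.orthogonal_imp_not_total by blast
qed

lemma complete_numbers_subset:
  assumes "N \<noteq> 1"
  shows "\<Gamma> \<subseteq> real ` {t. t > 0 \<and> coprime t N \<and> \<not> (q * N - 1) dvd t}"
proof
  fix t assume t: "t \<in> \<Gamma>"
  obtain k where k: "k > 0" "t = real k" using complete_number_nat[OF assms t] .
  have cop: "coprime k N"
  proof (rule ccontr)
    assume "\<not> coprime k N"
    hence g: "gcd k N \<noteq> 1" using coprime_iff_gcd_eq_1 by blast
    have "fourier \<mu> (1 - t * real_of_int l) = 0" for l
    proof -
      have "\<not> int N dvd 1 - int k * l"
      proof
        assume "int N dvd 1 - int k * l"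
        hence "int (gcd k N) dvd 1 - int k * l" by (meson dvd_trans gcd_dvd2 of_nat_dvd_iff)
        moreover have "int (gcd k N) dvd int k * l" by (intro dvd_mult2) simp
        ultimately have "int (gcd k N) dvd 1" by (metis diff_add_cancel dvd_add)
        thus False using g by simp
      qed
      from fourier_eq_0[OF this, of 0] show ?thesis by (simp add: k)
    qed
    thus False using complete_number_total[OF t] by blast
  qed
  have "\<not> (q * N - 1) dvd k"
  proof
    assume "(q * N - 1) dvd k"
    then obtain u where u: "k = (q * N - 1) * u" by blast
    have "coprime u N" using cop u by auto
    hence cu: "coprime (int u) (int N)" by simp
    have "int (q * N - 1) = bi - 1" using qN_ge_2 unfolding bi_def by linarith
    hence ku: "int k = (bi - 1) * int u" by (simp only: u of_nat_mult)
    \<comment> \<open>Here \<open>- u\<close> is \<open>- t / (b - 1)\<close>, and subtracting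
      \<open>t * l\<close> gives \<open>- u * (1 + (bi - 1) * l)\<close>. Coprimality of
      \<open>u\<close> and \<open>N\<close> keeps \<open>u * r\<close> off the multiples of
      \<open>N\<close>.\<close>
    have "fourier \<mu> (- real u - t * real_of_int l) = 0" if l: "l \<in> frequencies n" for l n
    proof -
      obtain j r where jr: "1 + (bi - 1) * l = bi ^ j * r" "\<not> int N dvd r"
        using frequencies_expansion[OF assms l] by blast
      have "\<not> int N dvd - int u * r"
        using jr(2) cu by (simp add: coprime_commute coprime_dvd_mult_right_iff)
      hence "fourier \<mu> (b ^ j * of_int (- int u * r)) = 0" by (rule fourier_eq_0)
      also have "b ^ j * of_int (- int u * r) = of_int (- int u * (bi ^ j * r))" by (simp add: b_eq)
      also have "- int u * (bi ^ j * r) = - int u - int k * l"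
        unfolding jr(1)[symmetric] ku by (simp add: algebra_simps)
      finally show ?thesis by (simp add: k)
    qed
    thus False using complete_number_total[OF t] by blast
  qed
  with k cop show "t \<in> real ` {t. t > 0 \<and> coprime t N \<and> \<not> (q * N - 1) dvd t}" by auto
qed

end

section \<open>Completeness via a harmonic function\<close>

lemma expo_cong: "l * x = m * y \<Longrightarrow> expo l x = expo m y"
  by (simp add: expo_def mult.assoc flip: of_real_mult)

text \<open>Pythagoras for an orthogonal projection: \<open>fourier M (s - l)\<close> is the
  coefficient of \<open>expo s\<close> along \<open>expo l\<close>. The distance to the span thus
  becomes a sum of squared transforms.\<close>

lemma (in real_distribution) bessel_equality:
  assumes F: "finite F" and orth: "\<And>l m. l \<in> F \<Longrightarrow> m \<in> F \<Longrightarrow> l \<noteq> m \<Longrightarrow> fourier M (l - m) = 0"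
  shows "(\<integral>x. (cmod (expo s x - (\<Sum>l\<in>F. fourier M (s - l) * expo l x)))\<^sup>2 \<partial>M)
    = 1 - (\<Sum>l\<in>F. (cmod (fourier M (s - l)))\<^sup>2)"
proof -
  define u where "u l = fourier M (s - l)" for l
  define h where "h x = expo s x - (\<Sum>l\<in>F. u l * expo l x)" for x
  have i: "integrable M (\<lambda>x. h x * cnj (expo m x))" for m
    unfolding h_def by (rule expo_diff_mult_cnj)
  have I: "(\<integral>x. h x * cnj (expo m x) \<partial>M) = fourier M (s - m) - (\<Sum>l\<in>F. u l * fourier M (l - m))" for m
    unfolding h_def by (rule expo_diff_mult_cnj)
  have I0: "(\<integral>x. h x * cnj (expo m x) \<partial>M) = 0" if m: "m \<in> F" for m
  proof -
    have "(\<Sum>l\<in>F. u l * fourier M (l - m)) = (\<Sum>l\<in>F. if l = m then u m else 0)"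
      using m orth by (intro sum.cong) (auto simp: fourier_0)
    thus ?thesis unfolding I using F m by (simp add: u_def)
  qed
  have "complex_of_real (\<integral>x. (cmod (h x))\<^sup>2 \<partial>M) = (\<integral>x. h x * cnj (h x) \<partial>M)"
    unfolding integral_complex_of_real[symmetric] complex_norm_square ..
  also have "\<dots> = (\<integral>x. h x * cnj (expo s x) - (\<Sum>l\<in>F. cnj (u l) * (h x * cnj (expo l x))) \<partial>M)"
    by (subst (2) h_def) (simp add: right_diff_distrib sum_distrib_left mult_ac)
  also have "\<dots> = (\<integral>x. h x * cnj (expo s x) \<partial>M) - (\<Sum>l\<in>F. cnj (u l) * (\<integral>x. h x * cnj (expo l x) \<partial>M))"
    by (subst Bochner_Integration.integral_diff) (auto simp: i intro!: Bochner_Integration.integrable_sum)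
  also have "\<dots> = 1 - (\<Sum>l\<in>F. u l * fourier M (l - s))"
    using I0 unfolding I[of s] by (simp add: fourier_0)
  also have "(\<Sum>l\<in>F. u l * fourier M (l - s)) = (\<Sum>l\<in>F. complex_of_real ((cmod (u l))\<^sup>2))"
  proof (intro sum.cong refl)
    fix l
    have "fourier M (l - s) = cnj (u l)" using fourier_minus[of "s - l"] by (simp add: u_def)
    thus "u l * fourier M (l - s) = complex_of_real ((cmod (u l))\<^sup>2)" by (simp only: complex_norm_square)
  qed
  also have "1 - \<dots> = complex_of_real (1 - (\<Sum>l\<in>F. (cmod (u l))\<^sup>2))" by simp
  finally show ?thesis unfolding of_real_eq_iff h_def u_def .
qed

text \<open>Set up for every positive \<open>p\<close> coprime to \<open>N\<close>, so that it
  serves for primes and, with \<open>p = 1\<close>, for the degenerate case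
  \<open>N = 1\<close>.\<close>

locale scaled_spectrum = cantor_measure +
  fixes p :: nat
  assumes p_pos: "p > 0" and p_coprime: "coprime p N"
begin

text \<open>The exponent \<open>j\<close> is the position of the lowest digit in which the
  expansions differ; distinct digits are incongruent modulo \<open>N\<close>.\<close>

lemma frequencies_diff:
  assumes "l \<in> frequencies n" "m \<in> frequencies n" "l \<noteq> m"
  shows "\<exists>j r. l - m = bi ^ j * r \<and> \<not> int N dvd r"
  using assms
proof (induction n arbitrary: l m)
  case (Suc n)
  obtain c l' where l: "l = c + bi * l'" "c \<in> Cint" "l' \<in> frequencies n"
    using Suc.prems(1) by (auto simp: frequencies.simps(2))
  obtain e m' where m: "m = e + bi * m'" "e \<in> Cint" "m' \<in> frequencies n"
    using Suc.prems(2) by (auto simp: frequencies.simps(2))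
  show ?case
  proof (cases "c = e")
    case True
    then obtain j r where "l' - m' = bi ^ j * r" "\<not> int N dvd r"
      using Suc.IH[OF l(3) m(3)] Suc.prems(3) l m by auto
    moreover have "l - m = bi * (l' - m')" using True by (simp add: l m algebra_simps)
    ultimately show ?thesis by (intro exI[of _ "Suc j"] exI[of _ r]) auto
  next
    case False
    have eq: "l - m = (c - e) + bi * (l' - m')" by (simp add: l m algebra_simps)
    have "\<not> int N dvd c - e" using False Cint_cong_imp_eq l(2) m(2) by blast
    hence "\<not> int N dvd l - m"
      unfolding eq using N_dvd_bi by (metis dvd_add_left_iff dvd_mult2)
    thus ?thesis by (intro exI[of _ 0] exI[of _ "l - m"]) auto
  qed
qed auto

lemma fourier_frequencies_diff:
  assumes "l \<in> frequencies n" "m \<in> frequencies n" "l \<noteq> m"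
  shows "fourier \<mu> (real p * of_int l - real p * of_int m) = 0"
proof -
  obtain j r where jr: "l - m = bi ^ j * r" "\<not> int N dvd r" using frequencies_diff[OF assms] by blast
  have "\<not> int N dvd int p * r"
    using jr(2) p_coprime by (simp add: coprime_commute coprime_dvd_mult_right_iff)
  hence "fourier \<mu> (b ^ j * of_int (int p * r)) = 0" by (rule fourier_eq_0)
  also have "b ^ j * of_int (int p * r) = of_int (int p * (l - m))" unfolding jr(1) by (simp add: b_eq)
  finally show ?thesis by (simp add: algebra_simps)
qed

lemma orthonormal: "orthonormal_exponentials \<mu> (\<Lambda> (real p))"
  unfolding orthonormal_exponentials_def
proof (intro ballI)
  fix l m assume "l \<in> \<Lambda> (real p)" "m \<in> \<Lambda> (real p)"
  then obtain n1 n2 l' m' where l: "l = real p * of_int l'" "l' \<in> frequencies n1"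
      and m: "m = real p * of_int m'" "m' \<in> frequencies n2" by (auto simp: \<Lambda>_def)
  have eq: "(\<integral>x. expo l x * cnj (expo m x) \<partial>\<mu>) = fourier \<mu> (l - m)"
    by (simp add: fourier_def cnj_expo flip: expo_add_left)
  have "l' \<in> frequencies (max n1 n2)" "m' \<in> frequencies (max n1 n2)"
    using l m frequencies_le[of n1 "max n1 n2"] frequencies_le[of n2 "max n1 n2"] by auto
  thus "(\<integral>x. expo l x * cnj (expo m x) \<partial>\<mu>) = (if l = m then 1 else 0)"
    unfolding eq using fourier_frequencies_diff l m by (auto simp: mu.fourier_0)
qed

text \<open>Orthogonality of the characters modulo \<open>N\<close>; multiplication by
  \<open>p\<close> merely permutes the residues.\<close>

lemma sum_expo_Cint:
  fixes x :: int
  shows "(\<Sum>c\<in>Cint. expo (real p * of_int x / real N) (of_int c)) = (if int N dvd x then of_nat N else 0)"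
proof -
  let ?l = "real p * of_int x / real N" and ?s = "real_of_int ((int N - 1) div 2)"
  have "inj_on (\<lambda>i. int i - (int N - 1) div 2) {..<N}" by (auto simp: inj_on_def)
  hence "(\<Sum>c\<in>Cint. expo ?l (of_int c)) = (\<Sum>i<N. expo ?l (1 * real i) * expo ?l (- ?s))"
    unfolding Cint_image by (subst sum.reindex) (simp_all flip: expo_add_right)
  also have "\<dots> = (if ?l * 1 \<in> \<int> then of_nat N else 0) * expo ?l (- ?s)"
    unfolding sum_distrib_right[symmetric] using N by (subst expo_sum_eq) auto
  also have "?l * 1 \<in> \<int> \<longleftrightarrow> int N dvd x"
  proof
    assume "?l * 1 \<in> \<int>"
    then obtain z :: int where "?l = of_int z" by (auto elim: Ints_cases)
    hence "real_of_int (int p * x) = of_int (z * int N)" using N by (simp add: field_simps)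
    hence "int p * x = z * int N" by (simp only: of_int_eq_iff)
    hence "int N dvd int p * x" by simp
    thus "int N dvd x" using p_coprime by (simp add: coprime_commute coprime_dvd_mult_right_iff)
  next
    assume "int N dvd x"
    then obtain z where "x = int N * z" by blast
    thus "?l * 1 \<in> \<int>" using N by simp
  qed
  \<comment> \<open>The phase caused by the shift of the digits is 1 if \<open>N\<close> divides
    \<open>x\<close>, and otherwise it multiplies 0.\<close>
  also have "(if int N dvd x then of_nat N else 0) * expo ?l (- ?s) = (if int N dvd x then of_nat N else 0 :: complex)"
  proof (cases "int N dvd x")
    case True
    then obtain z where "x = int N * z" by blast
    hence "?l = of_int (int p * z)" using N by simp
    hence "?l * (- ?s) \<in> \<int>" by (simp only: Ints_mult Ints_of_int Ints_minus)
    thus ?thesis using expo_eq_1_iff[of ?l "- ?s"] by auto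
  qed simp
  finally show ?thesis .
qed

definition \<tau> :: "int \<Rightarrow> real \<Rightarrow> real" where "\<tau> c \<xi> = (\<xi> + real p * of_int c) / b"

text \<open>Parseval: the matrix with entries \<open>expo (p * c / N) d\<close>, divided by the
  square root of \<open>N\<close>, is unitary, and the values \<open>mask (\<tau> c \<xi>)\<close>
  are the image of a unit vector under it.\<close>

lemma sum_mask_square: "(\<Sum>c\<in>Cint. (cmod (mask (\<tau> c \<xi>)))\<^sup>2) = 1"
proof -
  have sq: "complex_of_real ((cmod (mask (\<tau> c \<xi>)))\<^sup>2)
      = (\<Sum>d<N. \<Sum>e<N. expo (\<xi> / real N) (real d - real e) *
          expo (real p * of_int (int d - int e) / real N) (of_int c)) / (of_nat N)\<^sup>2" for c
  proof -
    have summand: "expo (\<tau> c \<xi>) (real q * real d) * cnj (expo (\<tau> c \<xi>) (real q * real e))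
        = expo (\<xi> / real N) (real d - real e) * expo (real p * of_int (int d - int e) / real N) (of_int c)" for d e
    proof -
      have "cnj (expo (\<tau> c \<xi>) (real q * real e)) = expo (\<tau> c \<xi>) (- (real q * real e))"
        unfolding cnj_expo by (rule expo_cong) simp
      hence "expo (\<tau> c \<xi>) (real q * real d) * cnj (expo (\<tau> c \<xi>) (real q * real e))
          = expo (\<tau> c \<xi>) (real q * (real d - real e))"
        by (simp add: right_diff_distrib flip: expo_add_right)
      also have "\<dots> = expo (\<xi> / real N + real p * of_int c / real N) (real d - real e)"
        using N q by (intro expo_cong) (simp add: \<tau>_def b_def field_simps)
      also have "\<dots> = expo (\<xi> / real N) (real d - real e) * expo (real p * of_int c / real N) (real d - real e)"
        by (rule expo_add_left)
      also have "expo (real p * of_int c / real N) (real d - real e)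
          = expo (real p * of_int (int d - int e) / real N) (of_int c)"
        by (rule expo_cong) simp
      finally show ?thesis .
    qed
    have "complex_of_real ((cmod (mask (\<tau> c \<xi>)))\<^sup>2)
        = (\<Sum>d<N. \<Sum>e<N. expo (\<tau> c \<xi>) (real q * real d) * cnj (expo (\<tau> c \<xi>) (real q * real e))) / (of_nat N)\<^sup>2"
      unfolding complex_norm_square mask_def by (simp add: sum_product power2_eq_square)
    thus ?thesis by (simp only: summand)
  qed
  have "complex_of_real (\<Sum>c\<in>Cint. (cmod (mask (\<tau> c \<xi>)))\<^sup>2)
      = (\<Sum>c\<in>Cint. \<Sum>d<N. \<Sum>e<N. expo (\<xi> / real N) (real d - real e) *
          expo (real p * of_int (int d - int e) / real N) (of_int c)) / (of_nat N)\<^sup>2"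
    by (simp only: of_real_sum sq sum_divide_distrib)
  also have "(\<Sum>c\<in>Cint. \<Sum>d<N. \<Sum>e<N. expo (\<xi> / real N) (real d - real e) *
          expo (real p * of_int (int d - int e) / real N) (of_int c))
      = (\<Sum>d<N. \<Sum>c\<in>Cint. \<Sum>e<N. expo (\<xi> / real N) (real d - real e) *
          expo (real p * of_int (int d - int e) / real N) (of_int c))"
    by (rule sum.swap)
  also have "\<dots> = (\<Sum>d<N. \<Sum>e<N. \<Sum>c\<in>Cint. expo (\<xi> / real N) (real d - real e) *
          expo (real p * of_int (int d - int e) / real N) (of_int c))"
    by (intro sum.cong refl, rule sum.swap)
  also have "\<dots> = (\<Sum>d<N. \<Sum>e<N. expo (\<xi> / real N) (real d - real e) *
          (if int N dvd int d - int e then of_nat N else 0))"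
    by (simp only: sum_distrib_left[symmetric] sum_expo_Cint)
  also have "\<dots> = (\<Sum>d<N. \<Sum>e<N. if e = d then of_nat N else 0)"
  proof (intro sum.cong refl)
    fix d e assume "d \<in> {..<N}" "e \<in> {..<N}"
    hence "\<bar>int d - int e\<bar> < int N" by auto
    hence "int N dvd int d - int e \<longleftrightarrow> e = d"
      using zdvd_not_zless[of "\<bar>int d - int e\<bar>" "int N"] by (cases "d = e") auto
    thus "expo (\<xi> / real N) (real d - real e) * (if int N dvd int d - int e then of_nat N else 0)
        = (if e = d then of_nat N else 0)" by auto
  qed
  also have "\<dots> = (of_nat N)\<^sup>2" by (simp add: power2_eq_square)
  finally have "complex_of_real (\<Sum>c\<in>Cint. (cmod (mask (\<tau> c \<xi>)))\<^sup>2) = complex_of_real 1" using N by simp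
  thus ?thesis by (simp only: of_real_eq_iff)
qed

section \<open>Sums of squared transforms over the dilated spectrum\<close>

definition Q :: "nat \<Rightarrow> real \<Rightarrow> real" where
  "Q n \<xi> = (\<Sum>l\<in>frequencies n. (cmod (fourier \<mu> (\<xi> + real p * of_int l)))\<^sup>2)"

text \<open>The lowest digit is absorbed into \<open>\<tau> c\<close>; what remains is the integer
  \<open>p * l\<close>, which the 1-periodic \<open>mask\<close> does not see.\<close>

lemma Q_Suc: "Q (Suc n) \<xi> = (\<Sum>c\<in>Cint. (cmod (mask (\<tau> c \<xi>)))\<^sup>2 * Q n (\<tau> c \<xi>))"
proof -
  have "Q (Suc n) \<xi> = (\<Sum>(c, l)\<in>Cint \<times> frequencies n.
      (cmod (fourier \<mu> (\<xi> + real p * of_int (c + bi * l))))\<^sup>2)"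
    unfolding Q_def frequencies.simps(2) sum.reindex[OF inj_on_frequencies] by (simp add: case_prod_unfold)
  also have "\<dots> = (\<Sum>(c, l)\<in>Cint \<times> frequencies n.
      (cmod (mask (\<tau> c \<xi>)))\<^sup>2 * (cmod (fourier \<mu> (\<tau> c \<xi> + real p * of_int l)))\<^sup>2)"
  proof (intro sum.cong refl, clarify)
    fix c l
    have eq: "(\<xi> + real p * of_int (c + bi * l)) / b = \<tau> c \<xi> + of_int (int p * l)"
      using b_pos by (simp add: \<tau>_def b_eq field_simps)
    have "fourier \<mu> (\<xi> + real p * of_int (c + bi * l)) = mask (\<tau> c \<xi>) * fourier \<mu> (\<tau> c \<xi> + of_int (int p * l))"
      by (subst fourier_step[OF self_similar_mu]) (simp only: eq mask_add_int[OF Ints_of_int])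
    thus "(cmod (fourier \<mu> (\<xi> + real p * of_int (c + bi * l))))\<^sup>2
        = (cmod (mask (\<tau> c \<xi>)))\<^sup>2 * (cmod (fourier \<mu> (\<tau> c \<xi> + real p * of_int l)))\<^sup>2"
      by (simp add: norm_mult power_mult_distrib)
  qed
  also have "\<dots> = (\<Sum>c\<in>Cint. (cmod (mask (\<tau> c \<xi>)))\<^sup>2 * Q n (\<tau> c \<xi>))"
    by (simp add: Q_def sum_distrib_left flip: sum.cartesian_product)
  finally show ?thesis .
qed

lemma Q_le_1: "Q n \<xi> \<le> 1"
proof (induction n arbitrary: \<xi>)
  case 0
  show ?case using mu.cmod_fourier_le[of \<xi>] by (simp add: Q_def power_le_one)
next
  case (Suc n)
  have "Q (Suc n) \<xi> \<le> (\<Sum>c\<in>Cint. (cmod (mask (\<tau> c \<xi>)))\<^sup>2 * 1)"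
    unfolding Q_Suc by (intro sum_mono mult_left_mono Suc.IH) auto
  thus ?case by (simp add: sum_mask_square)
qed

lemma incseq_Q: "incseq (\<lambda>n. Q n \<xi>)"
  unfolding Q_def by (intro incseq_SucI sum_mono2 finite_frequencies frequencies_mono) auto

lemma isCont_Q: "isCont (Q n) \<xi>"
  unfolding Q_def[abs_def]
  by (intro continuous_intros isCont_o2[OF _ mu.isCont_fourier])

text \<open>The full sum over the spectrum. As a supremum of continuous functions it is lower
  semicontinuous, and this is the regularity that the search for a minimum relies on.\<close>

definition Qlim :: "real \<Rightarrow> real" where "Qlim \<xi> = (SUP n. Q n \<xi>)"

lemma bdd_Q: "bdd_above (range (\<lambda>n. Q n \<xi>))"
  by (intro bdd_aboveI2[of _ _ 1] Q_le_1)

lemma Q_tendsto: "(\<lambda>n. Q n \<xi>) \<longlonglongrightarrow> Qlim \<xi>"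
  unfolding Qlim_def by (intro LIMSEQ_incseq_SUP bdd_Q incseq_Q)

lemma Q_le_Qlim: "Q n \<xi> \<le> Qlim \<xi>"
  unfolding Qlim_def by (intro cSUP_upper bdd_Q) auto

lemma Qlim_le_1: "Qlim \<xi> \<le> 1"
  by (rule LIMSEQ_le_const2[OF Q_tendsto]) (auto intro: Q_le_1)

lemma Qlim_step: "Qlim \<xi> = (\<Sum>c\<in>Cint. (cmod (mask (\<tau> c \<xi>)))\<^sup>2 * Qlim (\<tau> c \<xi>))"
proof (rule LIMSEQ_unique)
  show "(\<lambda>n. Q (Suc n) \<xi>) \<longlonglongrightarrow> Qlim \<xi>" using Q_tendsto by (rule LIMSEQ_Suc)
  show "(\<lambda>n. Q (Suc n) \<xi>) \<longlonglongrightarrow> (\<Sum>c\<in>Cint. (cmod (mask (\<tau> c \<xi>)))\<^sup>2 * Qlim (\<tau> c \<xi>))"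
    unfolding Q_Suc by (intro tendsto_intros Q_tendsto)
qed

text \<open>The defect in \<open>bessel_equality\<close> is \<open>1 - Q n (- s)\<close>: the
  arguments \<open>s - l\<close> and \<open>- s + l\<close> give conjugate transforms.\<close>

lemma expo_in_exp_closure:
  assumes "Qlim (- s) = 1"
  shows "expo s \<in> exp_closure \<mu> (\<Lambda> (real p))"
  unfolding exp_closure_def
proof (intro CollectI conjI allI impI mu.square_integrable_expo)
  fix \<epsilon> :: real assume "\<epsilon> > 0"
  hence "eventually (\<lambda>n. Q n (- s) > 1 - \<epsilon>) sequentially"
    using assms by (intro order_tendstoD(1)[OF Q_tendsto]) auto
  then obtain n where n: "Q n (- s) > 1 - \<epsilon>" by (meson eventually_happens trivial_limit_sequentially)
  define F where "F = (\<lambda>l. real p * of_int l) ` frequencies n"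
  have inj: "inj_on (\<lambda>l. real p * real_of_int l) (frequencies n)" using p_pos by (auto simp: inj_on_def)
  have "(\<integral>x. (cmod (expo s x - (\<Sum>l\<in>F. fourier \<mu> (s - l) * expo l x)))\<^sup>2 \<partial>\<mu>)
      = 1 - (\<Sum>l\<in>F. (cmod (fourier \<mu> (s - l)))\<^sup>2)"
  proof (rule mu.bessel_equality)
    show "finite F" unfolding F_def using finite_frequencies by simp
  qed (auto simp: F_def fourier_frequencies_diff)
  also have "(\<Sum>l\<in>F. (cmod (fourier \<mu> (s - l)))\<^sup>2) = Q n (- s)"
  proof -
    have "cmod (fourier \<mu> (s - x)) = cmod (fourier \<mu> (- s + x))" for x
    proof -
      have "cmod (fourier \<mu> (- (s - x))) = cmod (fourier \<mu> (s - x))"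
        by (simp only: mu.fourier_minus complex_mod_cnj)
      moreover have "- (s - x) = - s + x" by simp
      ultimately show ?thesis by simp
    qed
    thus ?thesis unfolding F_def Q_def sum.reindex[OF inj] by simp
  qed
  finally have "(\<integral>x. (cmod (expo s x - (\<Sum>l\<in>F. fourier \<mu> (s - l) * expo l x)))\<^sup>2 \<partial>\<mu>) < \<epsilon>"
    using n by simp
  thus "\<exists>F u. finite F \<and> F \<subseteq> \<Lambda> (real p) \<and> (\<integral>x. (cmod (expo s x - (\<Sum>l\<in>F. u l * expo l x)))\<^sup>2 \<partial>\<mu>) < \<epsilon>"
    by (intro exI[of _ F] exI[of _ "\<lambda>l. fourier \<mu> (s - l)"]) (auto simp: F_def \<Lambda>_def finite_frequencies)
qed

lemma complete_if_Qlim_eq_1: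
  assumes "\<And>\<xi>. Qlim \<xi> = 1"
  shows "real p \<in> \<Gamma>"
proof -
  have "countable (\<Lambda> (real p))" unfolding \<Lambda>_def
    by (intro countable_image countable_UN) (auto intro: countable_finite finite_frequencies)
  moreover have "total_exponentials \<mu> (\<Lambda> (real p))"
    using mu.exp_closure_UNIV[OF compact_Icc mu_compact expo_in_exp_closure[OF assms]]
    unfolding total_exponentials_def exp_closure_def by blast
  moreover have "\<exists>K. compact K \<and> measure \<mu> (- K) = 0" using mu_compact compact_Icc by blast
  ultimately show ?thesis using p_pos orthonormal mu.prob_space_axioms
    unfolding \<Gamma>_def spectral_pair_def by auto
qed

text \<open>Makes the interval from \<open>- R\<close> to \<open>R\<close> stable: adding
  \<open>p * c\<close> at most doubles \<open>R\<close>, and \<open>b \<ge> 2\<close> halves it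
  again.\<close>

lemma tau_abs_le:
  assumes "\<bar>x\<bar> \<le> R" "real p * real N \<le> R" "c \<in> Cint"
  shows "\<bar>\<tau> c x\<bar> \<le> R"
proof -
  have "\<bar>real_of_int c\<bar> \<le> real N" using assms(3) by (auto simp: Cint_def)
  hence "real p * \<bar>real_of_int c\<bar> \<le> real p * real N" by (intro mult_left_mono) auto
  hence "\<bar>x + real p * of_int c\<bar> \<le> 2 * R" 
    using assms(1,2) abs_triangle_ineq[of x "real p * of_int c"] by (simp add: abs_mult)
  also have "\<dots> \<le> b * R" using b_ge_2 assms(1) by (intro mult_right_mono) auto
  finally show ?thesis using b_pos by (simp add: \<tau>_def field_simps)
qed

text \<open>If \<open>Qlim\<close> is not constantly 1, its set of minimal points on a large interval is invariant under
  every \<open>\<tau> c\<close> of positive weight. A nonintegral minimal point would propagate along \<open>x / b ^ n\<close> to the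
  point 0, where \<open>Qlim\<close> is 1; hence all minimal points are integers.\<close>

lemma exists_integer_invariant_set:
  assumes "Qlim \<xi> \<noteq> 1"
  shows "\<exists>Z :: int set. finite Z \<and> Z \<noteq> {} \<and> 0 \<notin> Z \<and>
    (\<forall>x\<in>Z. \<exists>c\<in>Cint. \<exists>y\<in>Z. bi * y = x + int p * c)"
proof -
  define R where "R = \<bar>\<xi>\<bar> + real p * real N"
  have R: "\<bar>\<xi>\<bar> \<le> R" "real p * real N \<le> R" by (auto simp: R_def)
  define m where "m = Inf (Qlim ` {-R..R})"
  have nonneg: "0 \<le> Qlim x" for x using Q_le_Qlim[of 0 x] by (auto simp: Q_def intro: order_trans[rotated])
  have bdd: "bdd_below (Qlim ` {-R..R})" by (rule bdd_belowI2[of _ 0]) (rule nonneg)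
  have m_le: "m \<le> Qlim x" if "\<bar>x\<bar> \<le> R" for x
    unfolding m_def using that bdd by (intro cINF_lower) auto
  have m1: "m < 1" using m_le[OF R(1)] Qlim_le_1[of \<xi>] assms by linarith
  have Q00: "Q 0 0 = 1" by (simp add: Q_def mu.fourier_0)
  define Z0 where "Z0 = {x. \<bar>x\<bar> \<le> R \<and> Qlim x \<le> m}"
  have "\<exists>x. \<bar>x\<bar> \<le> R \<and> Qlim x < m + 1 / real (Suc k)" for k
  proof -
    have "{-R..R} \<noteq> {}" using R by auto
    thus ?thesis using cINF_less_iff[OF _ bdd, of "m + 1 / real (Suc k)"]
      unfolding m_def[symmetric] by (auto simp: abs_le_iff)
  qed
  then obtain X where X: "\<And>k. \<bar>X k\<bar> \<le> R" "\<And>k. Qlim (X k) < m + 1 / real (Suc k)" by metis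
  have "\<forall>k. X k \<in> {-R..R}" using X(1) by (auto simp: abs_le_iff) (metis minus_le_iff)
  then obtain x r where x: "x \<in> {-R..R}" "strict_mono r" "(X \<circ> r) \<longlonglongrightarrow> x"
    using compact_Icc[of "-R" R] unfolding compact_def by metis
  \<comment> \<open>Lower semicontinuity at work: \<open>Q n\<close> is continuous and lies below
    \<open>Qlim\<close>, so the bound passes from the minimizing sequence to its limit for every
    \<open>n\<close>.\<close>
  have "Q n x \<le> m" for n
  proof (rule LIMSEQ_le)
    show "(\<lambda>k. Q n ((X \<circ> r) k)) \<longlonglongrightarrow> Q n x" by (rule isCont_tendsto_compose[OF isCont_Q x(3)])
    have "(\<lambda>k. m + 1 / real (Suc (r k))) \<longlonglongrightarrow> m + 0"
      using LIMSEQ_subseq_LIMSEQ[OF LIMSEQ_Suc[OF lim_1_over_n] x(2)]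
      by (intro tendsto_intros) (simp add: o_def)
    thus "(\<lambda>k. m + 1 / real (Suc (r k))) \<longlonglongrightarrow> m" by simp
    have "Q n ((X \<circ> r) k) \<le> m + 1 / real (Suc (r k))" for k
      using X(2)[of "r k"] Q_le_Qlim[of n "X (r k)"] unfolding o_def by linarith
    thus "\<exists>N. \<forall>k\<ge>N. Q n ((X \<circ> r) k) \<le> m + 1 / real (Suc (r k))" by blast
  qed
  hence "Qlim x \<le> m" by (intro LIMSEQ_le_const2[OF Q_tendsto]) auto
  hence xZ: "x \<in> Z0" using x(1) by (auto simp: Z0_def abs_le_iff)
  have inv: "\<tau> c y \<in> Z0" if y: "y \<in> Z0" and c: "c \<in> Cint" "mask (\<tau> c y) \<noteq> 0" for y c
  proof (rule ccontr)
    have yR: "\<bar>y\<bar> \<le> R" and ym: "Qlim y \<le> m" using y by (auto simp: Z0_def)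
    have le: "\<bar>\<tau> c' y\<bar> \<le> R" if "c' \<in> Cint" for c' using tau_abs_le[OF yR R(2) that] .
    assume "\<tau> c y \<notin> Z0"
    hence gt: "m < Qlim (\<tau> c y)" using le[OF c(1)] by (auto simp: Z0_def)
    \<comment> \<open>\<open>Qlim y\<close> is a weighted mean of values at least \<open>m\<close>,
      so one larger value of positive weight would push it above \<open>m\<close>.\<close>
    have "(\<Sum>c\<in>Cint. (cmod (mask (\<tau> c y)))\<^sup>2 * m) < (\<Sum>c\<in>Cint. (cmod (mask (\<tau> c y)))\<^sup>2 * Qlim (\<tau> c y))"
    proof (rule sum_strict_mono_ex1[OF finite_Cint])
      show "\<forall>c\<in>Cint. (cmod (mask (\<tau> c y)))\<^sup>2 * m \<le> (cmod (mask (\<tau> c y)))\<^sup>2 * Qlim (\<tau> c y)"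
        by (intro ballI mult_left_mono m_le le) auto
      show "\<exists>c\<in>Cint. (cmod (mask (\<tau> c y)))\<^sup>2 * m < (cmod (mask (\<tau> c y)))\<^sup>2 * Qlim (\<tau> c y)"
        using c gt by (intro bexI[of _ c] mult_strict_left_mono) auto
    qed
    hence "m < Qlim y" using Qlim_step[of y] sum_mask_square[of y] by (simp flip: sum_distrib_right)
    thus False using ym by simp
  qed
  have int: "y \<in> \<int>" if y: "y \<in> Z0" for y
  proof (rule ccontr)
    assume "y \<notin> \<int>"
    have "y / b ^ n \<in> Z0 \<and> y / b ^ n \<notin> \<int>" for n
    proof (induction n)
      case (Suc n)
      let ?y = "y / b ^ n"
      have eq: "\<tau> 0 ?y = y / b ^ Suc n" by (simp add: \<tau>_def)
      have beq: "b * (y / b ^ Suc n) = ?y" using b_pos by simp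
      \<comment> \<open>A zero of \<open>mask\<close> at \<open>y / b ^ Suc n\<close> would make
        \<open>y / b ^ n\<close> an integer; hence the digit 0 has positive weight.\<close>
      have "mask (\<tau> 0 ?y) \<noteq> 0" unfolding mask_eq_0_iff eq beq using Suc by blast
      hence "y / b ^ Suc n \<in> Z0" using inv[of ?y 0] Suc zero_in_Cint unfolding eq by blast
      moreover have "y / b ^ Suc n \<notin> \<int>" using Suc beq Ints_mult[OF b_Ints, of "y / b ^ Suc n"] by metis
      ultimately show ?case by blast
    qed (use y \<open>y \<notin> \<int>\<close> in auto)
    hence "Qlim (y / b ^ n) \<le> m" for n by (simp add: Z0_def)
    hence "Q 0 (y / b ^ n) \<le> m" for n using Q_le_Qlim order_trans by blast
    hence "Q 0 0 \<le> m"
      by (intro LIMSEQ_le_const2[OF isCont_tendsto_compose[OF isCont_Q div_power_tendsto_0[of y]]]) auto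
    thus False using Q00 m1 by simp
  qed
  define Z where "Z = {z :: int. real_of_int z \<in> Z0}"
  have "Z \<subseteq> {-\<lceil>R\<rceil>..\<lceil>R\<rceil>}"
  proof
    fix z assume "z \<in> Z"
    hence "\<bar>real_of_int z\<bar> \<le> R" by (simp add: Z_def Z0_def)
    hence "\<bar>z\<bar> \<le> \<lceil>R\<rceil>" by (metis ceiling_mono ceiling_of_int of_int_abs)
    thus "z \<in> {-\<lceil>R\<rceil>..\<lceil>R\<rceil>}" by (auto simp: abs_le_iff)
  qed
  hence "finite Z" by (rule finite_subset) simp
  moreover have "Z \<noteq> {}" using xZ int[OF xZ] by (auto simp: Z_def elim!: Ints_cases)
  moreover have "0 \<notin> Z" using Q00 Q_le_Qlim[of 0 0] m1 by (auto simp: Z_def Z0_def)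
  moreover have "\<exists>c\<in>Cint. \<exists>y\<in>Z. bi * y = z + int p * c" if "z \<in> Z" for z
  proof -
    have z: "real_of_int z \<in> Z0" using that by (simp add: Z_def)
    have "\<exists>c\<in>Cint. mask (\<tau> c (of_int z)) \<noteq> 0"
    proof (rule ccontr)
      assume "\<not> ?thesis"
      hence "(\<Sum>c\<in>Cint. (cmod (mask (\<tau> c (of_int z))))\<^sup>2) = 0" by (intro sum.neutral) auto
      thus False by (simp add: sum_mask_square)
    qed
    then obtain c where c: "c \<in> Cint" "mask (\<tau> c (of_int z)) \<noteq> 0" by blast
    have y: "\<tau> c (of_int z) \<in> Z0" by (rule inv[OF z c])
    then obtain y :: int where yi: "\<tau> c (of_int z) = of_int y" using int by (blast elim: Ints_cases)
    have "real_of_int (bi * y) = of_int (z + int p * c)"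
      using yi b_pos by (simp add: \<tau>_def b_eq field_simps)
    hence "bi * y = z + int p * c" by (simp only: of_int_eq_iff)
    moreover have "y \<in> Z" using y yi by (simp add: Z_def)
    ultimately show ?thesis using c by blast
  qed
  ultimately show ?thesis by blast
qed

end

section \<open>Primes of large order are complete\<close>

context cantor_measure
begin

text \<open>Unrolling \<open>bi * f x = x + p * c\<close> along the orbit collects the digits,
  lowest first, into an expansion of length \<open>n\<close>.\<close>

lemma frequencies_orbit:
  fixes f :: "int \<Rightarrow> int"
  assumes f: "\<And>x. x \<in> P \<Longrightarrow> f x \<in> P \<and> (\<exists>c\<in>Cint. bi * f x = x + p * c)" and "x \<in> P"
  shows "(f ^^ n) x \<in> P \<and> (\<exists>l\<in>frequencies n. bi ^ n * (f ^^ n) x = x + p * l)"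
  using assms(2)
proof (induction n arbitrary: x)
  case (Suc n)
  obtain c where c: "c \<in> Cint" "bi * f x = x + p * c" using f[OF Suc.prems] by blast
  obtain l where l: "l \<in> frequencies n" "bi ^ n * (f ^^ n) (f x) = f x + p * l"
    using Suc.IH[of "f x"] f[OF Suc.prems] by blast
  have "bi ^ Suc n * (f ^^ Suc n) x = bi * (f x + p * l)"
    unfolding l(2)[symmetric] by (simp add: funpow_swap1)
  also have "\<dots> = x + p * (c + bi * l)" using c(2) by (simp add: algebra_simps)
  finally have "bi ^ Suc n * (f ^^ Suc n) x = x + p * (c + bi * l)" .
  moreover have "c + bi * l \<in> frequencies (Suc n)" using c l by (force simp: frequencies.simps(2))
  moreover have "(f ^^ Suc n) x \<in> P" using Suc.IH[of "f x"] f[OF Suc.prems] by (simp add: funpow_swap1)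
  ultimately show ?case by blast
qed simp

text \<open>A minimal invariant subset lies in \<open>(-p/2, p/2)\<close>, and modulo \<open>bi ^ k\<close> its points fall into the
  \<open>N ^ k\<close> classes of \<open>-p * frequencies k\<close>; so the orbit of any of its points is short, while its length
  is a multiple of the order of \<open>bi\<close> modulo \<open>p\<close>.\<close>

lemma invariant_set_imp_small_order:
  fixes Z :: "int set" and p k :: nat
  assumes N1: "N \<noteq> 1" and p: "prime p" "\<not> p dvd q * N" "p \<le> (q * N) ^ k"
    and Z: "finite Z" "Z \<noteq> {}" "0 \<notin> Z"
      "\<And>x. x \<in> Z \<Longrightarrow> \<exists>c\<in>Cint. \<exists>y\<in>Z. bi * y = x + int p * c"
  shows "\<exists>n\<in>{1..N ^ k}. p dvd (q * N) ^ n - 1"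
proof -
  have "\<forall>x\<in>Z. \<exists>y. y \<in> Z \<and> (\<exists>c\<in>Cint. bi * y = x + int p * c)" using Z(4) by blast
  then obtain f where f: "\<And>x. x \<in> Z \<Longrightarrow> f x \<in> Z \<and> (\<exists>c\<in>Cint. bi * f x = x + int p * c)"
    by metis
  have "f ` Z \<subseteq> Z" using f by blast
  \<comment> \<open>Minimal cardinality upgrades invariance to surjectivity of \<open>f\<close> on
    \<open>P\<close>, so that the point of largest modulus has a preimage in
    \<open>P\<close>.\<close>
  define invar where "invar P \<longleftrightarrow> P \<subseteq> Z \<and> P \<noteq> {} \<and> f ` P \<subseteq> P" for P
  have "invar Z" using \<open>f ` Z \<subseteq> Z\<close> Z(2) by (simp add: invar_def)
  then obtain P where "invar P" and least: "\<And>P'. invar P' \<Longrightarrow> card P \<le> card P'"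
    using ex_has_least_nat[of invar Z card] by blast
  hence P: "P \<subseteq> Z" "P \<noteq> {}" "f ` P \<subseteq> P" by (auto simp: invar_def)
  have finP: "finite P" using P(1) Z(1) by (rule finite_subset)
  have "card P \<le> card (f ` P)" using P by (intro least) (auto simp: invar_def)
  hence fP: "f ` P = P" using P(3) finP by (intro card_seteq) auto
  define M where "M = Max (abs ` P)"
  have M: "\<bar>x\<bar> \<le> M" if "x \<in> P" for x unfolding M_def using that finP by auto
  have "M \<in> abs ` P" unfolding M_def using finP P(2) by (intro Max_in) auto
  then obtain x where x: "x \<in> P" "M = \<bar>x\<bar>" by blast
  then obtain y where y: "y \<in> P" "x = f y" using fP by blast
  then obtain c where c: "c \<in> Cint" "bi * x = y + int p * c" using f P(1) by blast
  have p0: "p > 0" using p(1) by (rule prime_gt_0_nat)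
  have "\<bar>2 * c\<bar> \<le> int N" using c(1) by (auto simp: Cint_def)
  hence c2: "int p * \<bar>2 * c\<bar> \<le> int p * int N" by (intro mult_left_mono) auto
  \<comment> \<open>Comparing moduli in \<open>bi * x = y + p * c\<close> bounds \<open>M\<close> by
    \<open>p * N / (2 * (bi - 1))\<close>, which is below \<open>p / 2\<close> as
    \<open>N < bi - 1\<close>. Doubling keeps everything integral.\<close>
  have "2 * (bi * M) = \<bar>2 * (bi * x)\<bar>" using bi_pos by (simp add: x(2) abs_mult)
  also have "2 * (bi * x) = 2 * y + int p * (2 * c)" unfolding c(2) by simp
  also have "\<bar>2 * y + int p * (2 * c)\<bar> \<le> \<bar>2 * y\<bar> + int p * \<bar>2 * c\<bar>"
    using abs_triangle_ineq[of "2 * y" "int p * (2 * c)"] by (simp add: abs_mult)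
  also have "\<dots> \<le> 2 * M + int p * int N" using M[OF y(1)] c2 by simp
  finally have "(bi - 1) * (2 * M) \<le> int p * int N" by (simp add: algebra_simps)
  also have "int p * int N < int p * (bi - 1)"
  proof -
    have "N < q * N - 1"
    proof -
      have "2 * N \<le> q * N" using q by simp
      thus ?thesis using N N1 by linarith
    qed
    hence "int N < bi - 1" unfolding bi_def by linarith
    thus ?thesis using p0 by simp
  qed
  finally have "(bi - 1) * (2 * M) < (bi - 1) * int p" by (simp add: mult.commute)
  moreover have "bi - 1 > 0" using qN_ge_2 unfolding bi_def by linarith
  ultimately have Mp: "2 * M < int p" by (simp only: mult_less_cancel_left_pos)
  have small: "\<bar>x\<bar> < int p" if "x \<in> P" for x using M[OF that] Mp by linarith
  have orbit: "(f ^^ n) x \<in> P \<and> (\<exists>l\<in>frequencies n. bi ^ n * (f ^^ n) x = x + int p * l)"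
    if "x \<in> P" for n x
    by (rule frequencies_orbit[OF _ that]) (use f P in blast)
  have pk: "int p \<le> bi ^ k" unfolding bi_def using p(3) by (metis of_nat_le_iff of_nat_power)
  obtain g where g: "\<And>x. x \<in> P \<Longrightarrow> g x \<in> frequencies k \<and> bi ^ k * (f ^^ k) x = x + int p * g x"
    using orbit[of _ k] by metis
  have "inj_on g P"
  proof (rule inj_onI)
    fix x y assume xy: "x \<in> P" "y \<in> P" "g x = g y"
    hence "bi ^ k * ((f ^^ k) x - (f ^^ k) y) = x - y" using g[of x] g[of y] by (simp add: algebra_simps)
    hence "bi ^ k dvd \<bar>x - y\<bar>" by (metis dvd_abs_iff dvd_triv_left)
    moreover have "\<bar>x - y\<bar> < bi ^ k" using M[OF xy(1)] M[OF xy(2)] Mp pk by linarith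
    ultimately show "x = y" using zdvd_not_zless[of "\<bar>x - y\<bar>" "bi ^ k"] by auto
  qed
  hence "card P \<le> card (frequencies k)"
    using g by (intro card_inj_on_le[OF _ _ finite_frequencies]) auto
  hence cardP: "card P \<le> N ^ k" by (simp add: card_frequencies)
  define h where "h n = (f ^^ n) x" for n
  have hP: "h n \<in> P" for n unfolding h_def using orbit[OF x(1)] by blast
  have "\<not> inj_on h {..N ^ k}"
  proof
    assume "inj_on h {..N ^ k}"
    hence "card {..N ^ k} \<le> card P" using hP finP by (intro card_inj_on_le[of h]) auto
    thus False using cardP by simp
  qed
  then obtain i j where ij: "i < j" "j \<le> N ^ k" "h i = h j"
    unfolding inj_on_def by (metis atMost_iff linorder_neqE_nat)
  obtain l l' where "bi ^ i * h i = x + int p * l" "bi ^ j * h j = x + int p * l'"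
    unfolding h_def using orbit[OF x(1)] by blast
  \<comment> \<open>Subtracting the orbit identities at a repetition makes \<open>p\<close> divide
    \<open>bi ^ i * (bi ^ (j - i) - 1) * h i\<close>. Only the middle factor can be responsible,
    since \<open>0 < \<bar>h i\<bar> < p\<close> and \<open>p\<close> does not divide
    \<open>bi\<close>.\<close>
  hence "bi ^ j * h i - bi ^ i * h i = int p * (l' - l)" using ij(3) by (simp add: algebra_simps)
  moreover have "bi ^ j * h i - bi ^ i * h i = bi ^ i * ((bi ^ (j - i) - 1) * h i)"
    using ij(1) by (simp add: algebra_simps flip: power_add)
  ultimately have dvd: "int p dvd bi ^ i * ((bi ^ (j - i) - 1) * h i)" by simp
  have prime: "prime (int p)" using p(1) by simp
  have "\<not> int p dvd bi" unfolding bi_def using p(2) by (simp only: of_nat_dvd_iff not_False_eq_True)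
  hence "\<not> int p dvd bi ^ i" using prime prime_dvd_power by blast
  moreover have "\<not> int p dvd h i"
  proof
    assume "int p dvd h i"
    hence "int p dvd \<bar>h i\<bar>" by simp
    moreover have "h i \<noteq> 0" using hP[of i] P(1) Z(3) by auto
    ultimately show False using zdvd_not_zless[of "\<bar>h i\<bar>" "int p"] small[OF hP[of i]] by auto
  qed
  ultimately have "int p dvd bi ^ (j - i) - 1"
    using dvd prime by (auto simp: prime_dvd_mult_iff)
  also have "1 \<le> (q * N) ^ (j - i)" using qN_ge_2 by (intro one_le_power) linarith
  hence "bi ^ (j - i) - 1 = int ((q * N) ^ (j - i) - 1)"
    unfolding bi_def by (simp only: of_nat_diff of_nat_power of_nat_1)
  finally have "p dvd (q * N) ^ (j - i) - 1" by (simp only: of_nat_dvd_iff)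
  thus ?thesis using ij by (intro bexI[of _ "j - i"]) auto
qed

section \<open>Counting the incomplete primes and deriving the two bounds\<close>

lemma prime_complete:
  assumes "N \<noteq> 1" "prime p" "\<not> p dvd q * N" "p \<le> (q * N) ^ k" "real p \<notin> \<Gamma>"
  shows "\<exists>n\<in>{1..N ^ k}. p dvd (q * N) ^ n - 1"
proof -
  have "\<not> p dvd N" using assms(3) by auto
  then interpret scaled_spectrum N q p
    using assms(2) by unfold_locales (auto simp: prime_gt_0_nat prime_imp_coprime)
  obtain \<xi> where "Qlim \<xi> \<noteq> 1" using complete_if_Qlim_eq_1 assms(5) by blast
  from exists_integer_invariant_set[OF this] obtain Z where Z: "finite Z" "Z \<noteq> {}" "0 \<notin> Z"
    "\<forall>x\<in>Z. \<exists>c\<in>Cint. \<exists>y\<in>Z. bi * y = x + int p * c" by (elim exE conjE)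
  show ?thesis by (rule invariant_set_imp_small_order[OF assms(1-4) Z(1-3) bspec[OF Z(4)]])
qed

lemma card_incomplete_primes_le:
  assumes "N \<noteq> 1"
  shows "card {p. prime p \<and> p \<le> (q * N) ^ k \<and> real p \<notin> \<Gamma>} \<le> 2 * (q * N) * N ^ (2 * k)"
proof -
  let ?A = "{p. prime p \<and> (\<exists>n\<in>{1..N ^ k}. p dvd (q * N) ^ n - 1)}"
  \<comment> \<open>The interval takes care of the primes dividing \<open>b\<close>, to which the
    argument about orders does not apply.\<close>
  have "p \<in> ?A \<union> {1..q * N}" if p: "prime p" "p \<le> (q * N) ^ k" "real p \<notin> \<Gamma>" for p
  proof (cases "p dvd q * N")
    case True
    hence "p \<le> q * N" using N q by (intro dvd_imp_le) auto
    thus ?thesis using prime_gt_0_nat[OF p(1)] by simp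
  next
    case False
    have "\<exists>n\<in>{1..N ^ k}. p dvd (q * N) ^ n - 1" by (rule prime_complete[OF assms p(1) False p(2,3)])
    thus ?thesis using p(1) by simp
  qed
  hence "{p. prime p \<and> p \<le> (q * N) ^ k \<and> real p \<notin> \<Gamma>} \<subseteq> ?A \<union> {1..q * N}" by blast
  moreover note fin = card_primes_dvd_power_minus_one_le[OF qN_ge_2, of "N ^ k"]
  ultimately have "card {p. prime p \<and> p \<le> (q * N) ^ k \<and> real p \<notin> \<Gamma>} \<le> card (?A \<union> {1..q * N})"
    by (intro card_mono) auto
  also have "\<dots> \<le> card ?A + q * N" using card_Un_le[of ?A "{1..q * N}"] by simp
  also have "\<dots> \<le> q * N * (N ^ k)\<^sup>2 + q * N * (N ^ k)\<^sup>2" using fin(2) N by (intro add_mono) auto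
  also have "\<dots> = 2 * (q * N) * N ^ (2 * k)" by (simp flip: power_mult add: mult.commute)
  finally show ?thesis .
qed

lemma Limsup_complete_numbers:
  assumes "N \<noteq> 1"
  shows "Limsup at_top (\<lambda>x :: real. num_elements (\<Gamma> \<inter> {0..x}) / ennreal x)
    \<le> ennreal ((1 - 1 / real (q * N - 1)) * (real (totient N) / real N))"
proof (rule Limsup_coprime_not_dvd_le)
  show "coprime (q * N - 1) N"
  proof -
    have "coprime (q * N - 1) (q * N)" using N q by (intro coprime_diff_one_left_nat) auto
    thus ?thesis by simp
  qed
  show "N > 0" "q * N - 1 > 0" using N qN_ge_2 by linarith+
qed (rule complete_numbers_subset[OF assms])

lemma Liminf_complete_numbers:
  assumes "N \<noteq> 1" "q > N"
  shows "Liminf at_top (\<lambda>x :: real. num_elements (\<Gamma> \<inter> {0..x}) / ennreal (real (prime_count x))) \<ge> 1"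
proof (rule Liminf_primes_ge_1)
  show "N\<^sup>2 < q * N" using assms(2) N by (simp add: power2_eq_square)
  show "card {p. prime p \<and> p \<le> (q * N) ^ k \<and> real p \<notin> \<Gamma>} \<le> 2 * (q * N) * N ^ (2 * k)" for k
    by (rule card_incomplete_primes_le[OF assms(1)])
qed (rule qN_ge_2)

text \<open>The transform is constantly 1, and the spectrum reduces to 0 for every dilation, so
  completeness of \<open>t = 1\<close> is completeness of all positive \<open>t\<close>.\<close>

lemma Gamma_trivial:
  assumes "N = 1"
  shows "\<Gamma> = {0<..}"
proof -
  have "mask y = 1" for y by (subst mask_def) (simp add: assms)
  hence const: "fourier \<mu> \<xi> = fourier \<mu> (\<xi> / b ^ n)" for \<xi> n
    using fourier_iterate[OF self_similar_mu, of \<xi> n] by simp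
  have F: "fourier \<mu> \<xi> = 1" for \<xi>
    using isCont_tendsto_compose[OF mu.isCont_fourier div_power_tendsto_0[of \<xi>]]
    unfolding const[symmetric] mu.fourier_0 by (simp add: LIMSEQ_const_iff)
  interpret scaled_spectrum N q 1 by unfold_locales auto
  have "Qlim \<xi> = 1" for \<xi>
  proof -
    have "Q 0 \<xi> = 1" unfolding Q_def by (simp add: F)
    thus ?thesis using Qlim_le_1[of \<xi>] Q_le_Qlim[of 0 \<xi>] by linarith
  qed
  hence "1 \<in> \<Gamma>" using complete_if_Qlim_eq_1 by simp
  moreover have "Cint = {0}" by (subst Cint_def) (use assms in auto)
  hence "frequencies n = {0}" for n by (induction n) (auto simp: frequencies.simps(2))
  hence "\<Lambda> t = {0}" for t by (simp add: \<Lambda>_def)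
  ultimately show ?thesis by (auto simp: \<Gamma>_def)
qed

end

theorem theorem1p4:
  "\<exists>c :: nat \<Rightarrow> real. (\<forall>b. 0 < c b \<and> c b < 1) \<and>
     (\<forall>N q :: nat. N \<ge> 1 \<longrightarrow> q \<ge> 2 \<longrightarrow>
        (N \<noteq> 1 \<longrightarrow>
           Limsup at_top (\<lambda>x :: real.
             num_elements (positive_complete_numbers N q \<inter> {0..x}) / ennreal x)
           \<le> ennreal (c (q * N) * (real (totient N) / real N))) \<and>
        (q > N \<longrightarrow>
           Liminf at_top (\<lambda>x :: real.
             num_elements (positive_complete_numbers N q \<inter> {0..x}) / ennreal (real (prime_count x)))
           \<ge> 1))"
proof -
  \<comment> \<open>In the upper bound \<open>N\<close> and \<open>q\<close> are at least 2, so
    \<open>b \<ge> 4\<close>. The value 1/2 only keeps \<open>c\<close> strictly between 0 and 1 at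
    \<open>b \<le> 2\<close>, where \<open>1 - 1 / real (b - 1)\<close> evaluates to 0 or 1.\<close>
  define c :: "nat \<Rightarrow> real" where "c b = (if b \<ge> 3 then 1 - 1 / real (b - 1) else 1 / 2)" for b
  show ?thesis
  proof (intro exI[of _ c] conjI allI impI)
    show "0 < c b" "c b < 1" for b by (auto simp: c_def)
    fix N q :: nat assume Nq: "N \<ge> 1" "q \<ge> 2"
    interpret cantor_measure N q using Nq by unfold_locales
    show "Limsup at_top (\<lambda>x :: real. num_elements (positive_complete_numbers N q \<inter> {0..x}) / ennreal x)
        \<le> ennreal (c (q * N) * (real (totient N) / real N))" if "N \<noteq> 1"
    proof -
      have "2 * 2 \<le> q * N" using Nq that by (intro mult_le_mono) auto
      hence "c (q * N) = 1 - 1 / real (q * N - 1)" unfolding c_def by auto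
      thus ?thesis using Limsup_complete_numbers[OF that] by (simp only: positive_complete_numbers_eq)
    qed
    show "Liminf at_top (\<lambda>x :: real.
        num_elements (positive_complete_numbers N q \<inter> {0..x}) / ennreal (real (prime_count x))) \<ge> 1" if "q > N"
    proof (cases "N = 1")
      case False
      thus ?thesis using Liminf_complete_numbers[OF False that] by (simp only: positive_complete_numbers_eq)
    next
      case True
      \<comment> \<open>Here the complete numbers fill an interval, so the count, and with it the
        quotient, is infinite for every positive \<open>x\<close>.\<close>
      have "num_elements (positive_complete_numbers N q \<inter> {0..x}) / ennreal (real (prime_count x)) \<ge> 1" if "x > 0" for x
      proof -
        have "positive_complete_numbers N q \<inter> {0..x} = {0<..x}"
          unfolding positive_complete_numbers_eq Gamma_trivial[OF True] by auto
        hence "num_elements (positive_complete_numbers N q \<inter> {0..x}) = \<top>"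
          using that by (simp add: num_elements_def emeasure_count_space infinite_Ioc)
        thus ?thesis by (simp add: ennreal_top_divide)
      qed
      hence "\<forall>\<^sub>F x in at_top. 1 \<le> num_elements (positive_complete_numbers N q \<inter> {0..x}) / ennreal (real (prime_count x))"
        by (intro eventually_mono[OF eventually_gt_at_top[of 0]])
      thus ?thesis by (rule Liminf_bounded)
    qed
  qed
qed

end
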